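(* Let $M$ and $N$ be connected manifolds without boundary of the same dimension, let $f:M\to N$ be a map, and let the root classes of $f$ (at a point $c\in N$) be the Nielsen coincidence classes of the pair $(f,c)$, where $c$ also denotes the constant map $M\to N$ with value $c$. (i) If $f$ is orientable (that is, of Type I or Type II), then no root class of $f$ is defective. (ii) If $f$ is of Type III, then all root classes of $f$ are defective.
   Context: Maps are continuous. A loop in a manifold is orientation-preserving if translating a local orientation around it returns the same local orientation, and orientation-reversing otherwise. Types of maps. A map $f:M\to N$ is orientation-true if for each loop $\alpha$ in $M$, $f\circ\alpha$ is orientation-preserving if and only if $\alpha$ is orientation-preserving. $f$ is of Type I if it is orientation-true; of Type II if it is not orientation-true but does not map any orientation-reversing loop in $M$ to a contractible loop in $N$; of Type III if it maps some orientation-reversing loop in $M$ to a contractible loop in $N$. $f$ is called orientable if it is of Type I or II. Coincidence classes. For $f,g:M\to N$ let $Coin(f,g)=\{x\in M: f(x)=g(x)\}$. Points $x,y\in Coin(f,g)$ are Nielsen related if there is a path $w$ in $M$ from $x$ to $y$ such that $f\circ w$ and $g\circ w$ are homotopic relative to endpoints; the equivalence classes are the (Nielsen) coincidence classes. A point $x\in Coin(f,g)$ is self-reducing if there is a loop $\alpha$ in $M$ based at $x$ such that $f\circ\alpha\sim g\circ\alpha$ (relative to endpoints) and exactly one of the loops $\alpha$, $f\circ\alpha$ is orientation-preserving. A coincidence class is defective if it contains a self-reducing point. *)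

theory Defs
  imports "HOL-Homology.Homology"
begin

section \<open>Topological manifolds\<close>

definition second_countable_space :: "'a topology \<Rightarrow> bool" where
  "second_countable_space X \<longleftrightarrow>
     (\<exists>\<B>. countable \<B> \<and> (\<forall>V \<in> \<B>. openin X V) \<and>
        (\<forall>U x. openin X U \<and> x \<in> U \<longrightarrow> (\<exists>V \<in> \<B>. x \<in> V \<and> V \<subseteq> U)))"

definition topological_manifold :: "nat \<Rightarrow> 'a topology \<Rightarrow> bool" where
  "topological_manifold n M \<longleftrightarrow>
     Hausdorff_space M \<and> second_countable_space M \<and>
     (\<forall>x \<in> topspace M. \<exists>U V. openin M U \<and> x \<in> U \<and> openin (Euclidean_space n) V \<and>
        subtopology M U homeomorphic_space subtopology (Euclidean_space n) V)"

section \<open>Paths, loops and homotopies relative to endpoints\<close>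

definition loopin :: "'a topology \<Rightarrow> (real \<Rightarrow> 'a) \<Rightarrow> bool" where
  "loopin X \<alpha> \<longleftrightarrow> pathin X \<alpha> \<and> \<alpha> 0 = \<alpha> 1"

text \<open>The analogue of \<^const>\<open>homotopic_paths\<close> for abstract topologies.\<close>

definition homotopic_pathsin :: "'a topology \<Rightarrow> (real \<Rightarrow> 'a) \<Rightarrow> (real \<Rightarrow> 'a) \<Rightarrow> bool" where
  "homotopic_pathsin X p q \<longleftrightarrow>
     homotopic_with (\<lambda>r. r 0 = p 0 \<and> r 1 = p 1) (top_of_set {0..1}) X p q"

definition contractible_loop :: "'a topology \<Rightarrow> (real \<Rightarrow> 'a) \<Rightarrow> bool" where
  "contractible_loop X \<alpha> \<longleftrightarrow> loopin X \<alpha> \<and> homotopic_pathsin X \<alpha> (\<lambda>_. \<alpha> 0)"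

section \<open>Local orientations and their translation along paths\<close>

text \<open>A local orientation of an \<open>n\<close>-manifold at \<open>x\<close> is a generator of the infinite cyclic
  group \<open>H\<^sub>n(M, M - {x})\<close> (integer coefficients).\<close>

definition local_orientation :: "nat \<Rightarrow> 'a topology \<Rightarrow> 'a \<Rightarrow> 'a chain set \<Rightarrow> bool" where
  "local_orientation n M x \<mu> \<longleftrightarrow>
     (let H = relative_homology_group (int n) M (topspace M - {x})
      in \<mu> \<in> carrier H \<and> generate H {\<mu>} = carrier H)"

text \<open>A translation of local orientations along a path \<open>\<gamma>\<close> is a choice of a local
  orientation \<open>\<sigma> t\<close> at each \<open>\<gamma> t\<close> that is locally consistent: for \<open>s\<close> near \<open>t\<close>, the
  \<open>\<sigma> s\<close> are the restrictions of one class in \<open>H\<^sub>n(M, M - U)\<close> for a neighbourhood \<open>U\<close> of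
  \<open>\<gamma> t\<close>.  Consistency is in the parameter \<open>s\<close>, not in the point \<open>\<gamma> s\<close>, since \<open>\<gamma>\<close> may
  return to the same point with the other orientation.\<close>

definition orientation_translation ::
    "nat \<Rightarrow> 'a topology \<Rightarrow> (real \<Rightarrow> 'a) \<Rightarrow> (real \<Rightarrow> 'a chain set) \<Rightarrow> bool" where
  "orientation_translation n M \<gamma> \<sigma> \<longleftrightarrow>
     (\<forall>t \<in> {0..1}. local_orientation n M (\<gamma> t) (\<sigma> t)) \<and>
     (\<forall>t \<in> {0..1}. \<exists>U \<beta>. openin M U \<and> \<gamma> t \<in> U \<and>
        \<beta> \<in> carrier (relative_homology_group (int n) M (topspace M - U)) \<and>
        (\<exists>e>0. \<forall>s \<in> {0..1}. \<bar>s - t\<bar> < e \<longrightarrow>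
           \<gamma> s \<in> U \<and>
           hom_induced (int n) M (topspace M - U) M (topspace M - {\<gamma> s}) id \<beta> = \<sigma> s))"

definition orientation_preserving :: "nat \<Rightarrow> 'a topology \<Rightarrow> (real \<Rightarrow> 'a) \<Rightarrow> bool" where
  "orientation_preserving n M \<alpha> \<longleftrightarrow>
     (\<forall>\<mu>. local_orientation n M (\<alpha> 0) \<mu> \<longrightarrow>
        (\<exists>\<sigma>. orientation_translation n M \<alpha> \<sigma> \<and> \<sigma> 0 = \<mu> \<and> \<sigma> 1 = \<mu>))"

definition orientation_reversing :: "nat \<Rightarrow> 'a topology \<Rightarrow> (real \<Rightarrow> 'a) \<Rightarrow> bool" where
  "orientation_reversing n M \<alpha> \<longleftrightarrow> \<not> orientation_preserving n M \<alpha>"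

section \<open>Types of maps\<close>

definition orientation_true ::
    "nat \<Rightarrow> 'a topology \<Rightarrow> 'b topology \<Rightarrow> ('a \<Rightarrow> 'b) \<Rightarrow> bool" where
  "orientation_true n M N f \<longleftrightarrow>
     (\<forall>\<alpha>. loopin M \<alpha> \<longrightarrow>
        (orientation_preserving n N (f \<circ> \<alpha>) \<longleftrightarrow> orientation_preserving n M \<alpha>))"

definition type_I :: "nat \<Rightarrow> 'a topology \<Rightarrow> 'b topology \<Rightarrow> ('a \<Rightarrow> 'b) \<Rightarrow> bool" where
  "type_I n M N f \<longleftrightarrow> orientation_true n M N f"

definition type_III :: "nat \<Rightarrow> 'a topology \<Rightarrow> 'b topology \<Rightarrow> ('a \<Rightarrow> 'b) \<Rightarrow> bool" where
  "type_III n M N f \<longleftrightarrow>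
     (\<exists>\<alpha>. loopin M \<alpha> \<and> orientation_reversing n M \<alpha> \<and> contractible_loop N (f \<circ> \<alpha>))"

definition type_II :: "nat \<Rightarrow> 'a topology \<Rightarrow> 'b topology \<Rightarrow> ('a \<Rightarrow> 'b) \<Rightarrow> bool" where
  "type_II n M N f \<longleftrightarrow>
     \<not> orientation_true n M N f \<and>
     \<not> (\<exists>\<alpha>. loopin M \<alpha> \<and> orientation_reversing n M \<alpha> \<and> contractible_loop N (f \<circ> \<alpha>))"

definition orientable_map :: "nat \<Rightarrow> 'a topology \<Rightarrow> 'b topology \<Rightarrow> ('a \<Rightarrow> 'b) \<Rightarrow> bool" where
  "orientable_map n M N f \<longleftrightarrow> type_I n M N f \<or> type_II n M N f"

section \<open>Coincidence classes\<close>

definition Coin :: "'a topology \<Rightarrow> ('a \<Rightarrow> 'b) \<Rightarrow> ('a \<Rightarrow> 'b) \<Rightarrow> 'a set" where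
  "Coin M f g = {x \<in> topspace M. f x = g x}"

definition Nielsen_related ::
    "'a topology \<Rightarrow> 'b topology \<Rightarrow> ('a \<Rightarrow> 'b) \<Rightarrow> ('a \<Rightarrow> 'b) \<Rightarrow> ('a \<times> 'a) set" where
  "Nielsen_related M N f g =
     {(x, y). x \<in> Coin M f g \<and> y \<in> Coin M f g \<and>
        (\<exists>w. pathin M w \<and> w 0 = x \<and> w 1 = y \<and> homotopic_pathsin N (f \<circ> w) (g \<circ> w))}"

definition coincidence_classes ::
    "'a topology \<Rightarrow> 'b topology \<Rightarrow> ('a \<Rightarrow> 'b) \<Rightarrow> ('a \<Rightarrow> 'b) \<Rightarrow> 'a set set" where
  "coincidence_classes M N f g = Coin M f g // Nielsen_related M N f g"

definition self_reducing ::
    "nat \<Rightarrow> 'a topology \<Rightarrow> 'b topology \<Rightarrow> ('a \<Rightarrow> 'b) \<Rightarrow> ('a \<Rightarrow> 'b) \<Rightarrow> 'a \<Rightarrow> bool" where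
  "self_reducing n M N f g x \<longleftrightarrow>
     x \<in> Coin M f g \<and>
     (\<exists>\<alpha>. loopin M \<alpha> \<and> \<alpha> 0 = x \<and> homotopic_pathsin N (f \<circ> \<alpha>) (g \<circ> \<alpha>) \<and>
        (orientation_preserving n M \<alpha> \<noteq> orientation_preserving n N (f \<circ> \<alpha>)))"

definition defective ::
    "nat \<Rightarrow> 'a topology \<Rightarrow> 'b topology \<Rightarrow> ('a \<Rightarrow> 'b) \<Rightarrow> ('a \<Rightarrow> 'b) \<Rightarrow> 'a set \<Rightarrow> bool" where
  "defective n M N f g C \<longleftrightarrow> (\<exists>x \<in> C. self_reducing n M N f g x)"

definition root_classes ::
    "'a topology \<Rightarrow> 'b topology \<Rightarrow> ('a \<Rightarrow> 'b) \<Rightarrow> 'b \<Rightarrow> 'a set set" where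
  "root_classes M N f c = coincidence_classes M N f (\<lambda>_. c)"

end

(* A loop contracting to a point is orientation-preserving: over the square parametrising the
   contraction a local orientation extends to a locally consistent family, and that family is
   constant along the three sides that are mapped to the base point. This gives (i), because a
   self-reducing root would then be the base point of a reversing loop with contractible image.
   For (ii), conjugating a reversing loop with contractible image by a path from the given root
   yields a reversing loop at the root whose image is again contractible.

   Local constancy rests on H_n(M, M - U) \<cong> H_n(M, M - y) for every point y of a coordinate ball U.
   Pushing points radially away from y inside a larger ball deforms M - y into M - U, so that
   H_*(M - y, M - U) = 0 and the exact sequence of the triple applies; neither excision nor the value
   of the groups is needed. *)

theory Submission
  imports Defs
begin

section \<open>Local homology of coordinate balls\<close>

text \<open>A translation is indexed by the parameter, because a path may meet a point again with
  the other orientation; it need not come from a section over the manifold. Hence all arguments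
  concern families over a parameter set: two families that agree at one parameter agree on a
  connected set, and over an interval or a square a family with a prescribed value exists. Since
  \<open>orientation_reversing\<close> denies the existence of suitable translations, uniqueness is
  what carries reversal from a loop to its conjugate. The radii answer two demands on a push away
  from a point \<open>p\<close> that lies within \<open>r\<close> of the centre of a ball. Reaching
  distance \<open>2 * r\<close> from \<open>p\<close> is enough to leave the ball of radius
  \<open>r\<close>, and a point that moves stays within \<open>3 * r\<close> of the centre, hence in
  the chart.\<close>

lemma restriction_bij_if_deformation:
  assumes "T \<subseteq> S"
    and h: "continuous_map (prod_topology (top_of_set {0..1::real}) (subtopology X S)) (subtopology X S) h"
    and h0: "\<And>x. x \<in> topspace X \<inter> S \<Longrightarrow> h (0, x) = x"
    and h1: "\<And>x. x \<in> topspace X \<inter> S \<Longrightarrow> h (1, x) \<in> T"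
    and hT: "\<And>s x. s \<in> {0..1} \<Longrightarrow> x \<in> topspace X \<inter> T \<Longrightarrow> h (s, x) \<in> T"
  shows "hom_induced p X T X S id \<in> iso (relative_homology_group p X T) (relative_homology_group p X S)"
proof -
  let ?S = "subtopology X S" and ?r = "\<lambda>x. h (1, x)"
  have ST: "subtopology ?S T = subtopology X T"
    using assms(1) by (simp add: subtopology_subtopology inf.absorb2)
  have hom: "homotopic_with (\<lambda>k. True) ?S ?S ?r id"
  proof -
    have "homotopic_with (\<lambda>k. True) ?S ?S id ?r"
      unfolding homotopic_with [of _ "\<lambda>k. True", simplified] using h h0
      by (intro exI [of _ h]) simp
    then show ?thesis by (rule homotopic_with_symD)
  qed
  \<comment> \<open>Only invariance of \<open>T\<close> is asked, not that its points stay fixed: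
    \<open>?r\<close> is then a homotopy inverse of the inclusion of \<open>T\<close> in
    \<open>S\<close>, both composites being homotopic to the identity.\<close>
  have homT: "homotopic_with (\<lambda>k. True) (subtopology ?S T) (subtopology ?S T) ?r id"
  proof -
    have "continuous_map (prod_topology (top_of_set {0..1}) (subtopology ?S T)) ?S h"
      unfolding prod_topology_subtopology(2) [of _ ?S T]
      by (rule continuous_map_from_subtopology [OF h])
    moreover have "h (s, x) \<in> T" if "s \<in> {0..1}" "x \<in> topspace X" "x \<in> T" for s x
      using hT that by auto
    ultimately have c: "continuous_map (prod_topology (top_of_set {0..1}) (subtopology ?S T)) (subtopology ?S T) h"
      by (auto simp: continuous_map_in_subtopology)
    have "homotopic_with (\<lambda>k. True) (subtopology ?S T) (subtopology ?S T) id ?r"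
      unfolding homotopic_with [of _ "\<lambda>k. True", simplified] using c h0 \<open>T \<subseteq> S\<close>
      by (intro exI [of _ h]) auto
    then show ?thesis by (rule homotopic_with_symD)
  qed
  have r: "continuous_map ?S (subtopology ?S T) ?r"
    using homotopic_with_imp_continuous_maps [OF hom] h1 by (auto simp: continuous_map_in_subtopology)
  have triv: "trivial_group (relative_homology_group q ?S T)" for q
    using trivial_relative_homology_group_gen [OF r homT hom] .
  let ?i = "hom_induced p X T X S id"
  \<comment> \<open>Triviality of the homology of the pair (S, T) enters in two degrees: degree
    \<open>p\<close> gives injectivity here, and degree \<open>p - 1\<close>, the target of the
    boundary map, gives surjectivity below.\<close>
  have ker: "kernel (relative_homology_group p X T) (relative_homology_group p X S) ?i
      = {\<one>\<^bsub>relative_homology_group p X T\<^esub>}"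
    using homology_exactness_triple_3 [OF assms(1), of p X] triv [of p]
      hom_one [OF hom_induced_hom [of p ?S T X T id]]
    by (simp add: trivial_group_def)
  have img: "?i ` carrier (relative_homology_group p X T) = carrier (relative_homology_group p X S)"
  proof -
    have "kernel (relative_homology_group p X S) (relative_homology_group (p - 1) ?S T) (hom_relboundary p X S T)
        = carrier (relative_homology_group p X S)"
      using triv [of "p - 1"] hom_relboundary [of p X S T]
      by (auto simp: kernel_def trivial_group_def)
    then show ?thesis
      using homology_exactness_triple_1 [OF assms(1), of p X] by simp
  qed
  have "group_hom (relative_homology_group p X T) (relative_homology_group p X S) ?i"
    by (simp add: group_hom_def group_hom_axioms_def hom_induced_hom)
  then show ?thesis
    using group_hom.inj_iff_trivial_ker ker img
    by (fastforce simp: iso_def bij_betw_def hom_induced_hom)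
qed

section \<open>l1 balls in Euclidean space and the radial push\<close>

lemma l1_triangle:
  fixes u v w :: "nat \<Rightarrow> real"
  shows "(\<Sum>i<n. \<bar>u i - w i\<bar>) \<le> (\<Sum>i<n. \<bar>u i - v i\<bar>) + (\<Sum>i<n. \<bar>v i - w i\<bar>)"
  unfolding sum.distrib [symmetric] by (rule sum_mono) auto

text \<open>The l1 distance over the first \<open>n\<close> coordinates plays the part of a norm: as
  a finite sum of coordinate functions it fits the product topology. A basic open box around
  \<open>a\<close> restricts \<open>v\<close> only in these coordinates, since the others vanish on
  the model space.\<close>

lemma Euclidean_space_contains_l1_ball:
  assumes "openin (Euclidean_space n) V" "a \<in> V"
  obtains r where "r > 0" "\<And>v. v \<in> topspace (Euclidean_space n) \<Longrightarrow> (\<Sum>i<n. \<bar>v i - a i\<bar>) \<le> r \<Longrightarrow> v \<in> V"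
proof -
  obtain T where T: "openin (powertop_real UNIV) T" "V = T \<inter> {x. \<forall>i\<ge>n. x i = 0}"
    using assms(1) unfolding Euclidean_space_def openin_subtopology by blast
  obtain X where X: "a \<in> (\<Pi>\<^sub>E i\<in>UNIV. X i)" "\<And>i. openin euclideanreal (X i)" "(\<Pi>\<^sub>E i\<in>UNIV. X i) \<subseteq> T"
    using product_topology_open_contains_basis [OF T(1), of a] assms(2) T(2) by auto
  have "\<exists>e>0. \<forall>y. \<bar>y - a i\<bar> < e \<longrightarrow> y \<in> X i" for i
  proof -
    have "open (X i)" "a i \<in> X i"
      using X(1,2) by auto
    then show ?thesis
      unfolding open_dist dist_real_def by blast
  qed
  then obtain e where e: "\<And>i. e i > 0" "\<And>i y. \<bar>y - a i\<bar> < e i \<Longrightarrow> y \<in> X i"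
    by metis
  \<comment> \<open>The inserted 1 covers \<open>n = 0\<close>, where the minimum would be over the
    empty set; halving makes the closed ball lie strictly inside the open intervals.\<close>
  define r where "r = Min (insert 1 (e ` {..<n})) / 2"
  have "r > 0"
    using e(1) by (auto simp: r_def)
  moreover have "v \<in> V" if v: "v \<in> topspace (Euclidean_space n)" "(\<Sum>i<n. \<bar>v i - a i\<bar>) \<le> r" for v
  proof -
    have "v i \<in> X i" for i
    proof (cases "i < n")
      case True
      then have "Min (insert 1 (e ` {..<n})) \<le> e i"
        by (intro Min_le) auto
      moreover have "\<bar>v i - a i\<bar> \<le> (\<Sum>i<n. \<bar>v i - a i\<bar>)"
        using True by (intro member_le_sum) auto
      moreover have "r < Min (insert 1 (e ` {..<n}))"
        using \<open>r > 0\<close> unfolding r_def by linarith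
      ultimately show ?thesis
        using v(2) by (intro e(2)) linarith
    next
      case False
      then have "v i = a i"
        using v(1) assms(2) T(2) by (simp add: topspace_Euclidean_space)
      then show ?thesis using X(1) by auto
    qed
    then show ?thesis
      using X(3) T(2) v(1) by (auto simp: topspace_Euclidean_space)
  qed
  ultimately show ?thesis using that by blast
qed

text \<open>A closed subset of a product of compact intervals, with factor \<open>{0}\<close> in the
  coordinates from \<open>n\<close> on, so Tychonoff applies. Compactness, unlike closedness,
  survives the passage from the chart to the manifold.\<close>

lemma compactin_l1_ball:
  "compactin (Euclidean_space n) {v \<in> topspace (Euclidean_space n). (\<Sum>i<n. \<bar>v i - a i\<bar>) \<le> r}"
    (is "compactin _ ?B")
proof -
  let ?K = "\<Pi>\<^sub>E i\<in>UNIV. if i < n then {a i - r..a i + r} else {0}"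
  have K: "compactin (powertop_real UNIV) ?K"
    unfolding compactin_PiE by auto
  have sub: "?B \<subseteq> ?K"
  proof
    fix v assume v: "v \<in> ?B"
    have "\<bar>v i - a i\<bar> \<le> r" if "i < n" for i
    proof -
      have "\<bar>v i - a i\<bar> \<le> (\<Sum>i<n. \<bar>v i - a i\<bar>)"
        using that by (intro member_le_sum) auto
      then show ?thesis using v by simp
    qed
    then show "v \<in> ?K"
      using v by (fastforce simp: topspace_Euclidean_space abs_le_iff)
  qed
  have "closedin (powertop_real UNIV) {v. (\<Sum>i<n. \<bar>v i - a i\<bar>) \<le> r}"
    unfolding euclidean_product_topology closed_closedin [symmetric]
    by (intro closed_Collect_le continuous_intros continuous_on_product_coordinates)
  then have "closedin (powertop_real UNIV) (topspace (Euclidean_space n) \<inter> {v. (\<Sum>i<n. \<bar>v i - a i\<bar>) \<le> r})"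
    by (intro closedin_Int closedin_Euclidean_space)
  then have "closedin (powertop_real UNIV) ?B"
    by (simp add: Collect_conj_eq)
  then have "compactin (powertop_real UNIV) ?B"
    using closed_compactin [OF K sub] by blast
  then show ?thesis
    unfolding Euclidean_space_def by (auto simp: compactin_subtopology)
qed

text \<open>Points at \<open>\<ell>\<^sup>1\<close>-distance less than \<open>2 r\<close> from \<open>p\<close> move away from \<open>p\<close> along rays and reach
  distance \<open>2 r\<close> at time 1; all other points stay fixed. Junk value: \<open>p\<close> itself is also fixed.\<close>

definition push :: "nat \<Rightarrow> (nat \<Rightarrow> real) \<Rightarrow> real \<Rightarrow> real \<Rightarrow> (nat \<Rightarrow> real) \<Rightarrow> nat \<Rightarrow> real" where
  "push n p r s v i = p i + ((1 - s) + s * max 1 (2 * r / (\<Sum>j<n. \<bar>v j - p j\<bar>))) * (v i - p i)"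

lemma push_0 [simp]: "push n p r 0 v = v"
  by (simp add: push_def fun_eq_iff)

lemma push_Euclidean:
  "p \<in> topspace (Euclidean_space n) \<Longrightarrow> v \<in> topspace (Euclidean_space n) \<Longrightarrow>
    push n p r s v \<in> topspace (Euclidean_space n)"
  by (simp add: push_def topspace_Euclidean_space)

lemma push_far:
  assumes "(\<Sum>j<n. \<bar>v j - p j\<bar>) \<ge> 2 * r" "(\<Sum>j<n. \<bar>v j - p j\<bar>) > 0"
  shows "push n p r s v = v"
proof -
  have "max 1 (2 * r / (\<Sum>j<n. \<bar>v j - p j\<bar>)) = 1"
    using assms by (simp add: max_def)
  then show ?thesis by (simp add: push_def fun_eq_iff)
qed

context
  fixes n :: nat and p v :: "nat \<Rightarrow> real" and r s k :: real
  defines "k \<equiv> (1 - s) + s * max 1 (2 * r / (\<Sum>j<n. \<bar>v j - p j\<bar>))"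
  assumes s: "s \<in> {0..1}"
begin

lemma push_factor_ge_1: "k \<ge> 1"
proof -
  have "s * 1 \<le> s * max 1 (2 * r / (\<Sum>j<n. \<bar>v j - p j\<bar>))"
    using s by (intro mult_left_mono) auto
  then show ?thesis by (simp add: k_def)
qed

lemma push_eq: "push n p r s v i - p i = k * (v i - p i)"
  by (simp add: push_def k_def)

lemma push_dist_center: "(\<Sum>i<n. \<bar>push n p r s v i - p i\<bar>) = k * (\<Sum>i<n. \<bar>v i - p i\<bar>)"
  using push_factor_ge_1 by (simp add: push_eq abs_mult sum_distrib_left)

lemma push_ge_dist: "(\<Sum>i<n. \<bar>v i - p i\<bar>) \<le> (\<Sum>i<n. \<bar>push n p r s v i - p i\<bar>)"
  using mult_right_mono [OF push_factor_ge_1, of "\<Sum>i<n. \<bar>v i - p i\<bar>"]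
  by (simp add: push_dist_center sum_nonneg)

text \<open>The new distance is the convex combination of the old one and \<open>2 * r\<close> with
  weights \<open>1 - s\<close> and \<open>s\<close>.\<close>

lemma push_near:
  assumes "(\<Sum>j<n. \<bar>v j - p j\<bar>) < 2 * r" "(\<Sum>j<n. \<bar>v j - p j\<bar>) > 0"
  shows "(\<Sum>i<n. \<bar>push n p r s v i - p i\<bar>) \<le> 2 * r"
proof -
  let ?N = "\<Sum>j<n. \<bar>v j - p j\<bar>"
  have "max 1 (2 * r / ?N) = 2 * r / ?N"
    using assms by (simp add: max_def field_simps)
  then have "k * ?N = (1 - s) * ?N + s * (2 * r)"
    using assms by (simp add: k_def field_simps)
  also have "\<dots> \<le> (1 - s) * (2 * r) + s * (2 * r)"
    using s assms by (intro add_mono mult_left_mono) auto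
  finally show ?thesis
    by (simp add: push_dist_center algebra_simps)
qed

text \<open>A ray from a point of a convex set does not enter the set again after leaving it. Indeed
  \<open>v\<close> is the convex combination of the pushed point and \<open>p\<close> with weights
  \<open>1 / k\<close> and \<open>(k - 1) / k\<close>; as \<open>p\<close> is within
  \<open>r\<close> of \<open>a\<close> and \<open>v\<close> is not, the pushed point cannot be
  either.\<close>

lemma push_outside_ball:
  assumes p: "(\<Sum>i<n. \<bar>p i - a i\<bar>) < r" and v: "(\<Sum>i<n. \<bar>v i - a i\<bar>) \<ge> r"
  shows "(\<Sum>i<n. \<bar>push n p r s v i - a i\<bar>) \<ge> r"
proof -
  have "k * (\<Sum>i<n. \<bar>v i - a i\<bar>) = (\<Sum>i<n. \<bar>k * (v i - a i)\<bar>)"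
    using push_factor_ge_1 by (simp add: abs_mult sum_distrib_left)
  also have "\<dots> = (\<Sum>i<n. \<bar>(push n p r s v i - a i) + (k - 1) * (p i - a i)\<bar>)"
    using push_eq by (intro sum.cong refl arg_cong [where f = abs]) (simp add: algebra_simps eq_diff_eq diff_eq_eq)
  also have "\<dots> \<le> (\<Sum>i<n. \<bar>push n p r s v i - a i\<bar> + (k - 1) * \<bar>p i - a i\<bar>)"
    using push_factor_ge_1 by (intro sum_mono) (metis abs_triangle_ineq abs_mult abs_of_nonneg diff_ge_0_iff_ge)
  also have "\<dots> = (\<Sum>i<n. \<bar>push n p r s v i - a i\<bar>) + (k - 1) * (\<Sum>i<n. \<bar>p i - a i\<bar>)"
    by (simp add: sum.distrib sum_distrib_left)
  finally have "k * (\<Sum>i<n. \<bar>v i - a i\<bar>) \<le> (\<Sum>i<n. \<bar>push n p r s v i - a i\<bar>) + (k - 1) * (\<Sum>i<n. \<bar>p i - a i\<bar>)" .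
  moreover have "k * r \<le> k * (\<Sum>i<n. \<bar>v i - a i\<bar>)" "(k - 1) * (\<Sum>i<n. \<bar>p i - a i\<bar>) \<le> (k - 1) * r"
    using push_factor_ge_1 p v by (auto intro!: mult_left_mono)
  ultimately show ?thesis by (simp add: algebra_simps)
qed

end

lemma push_1_far:
  assumes "(\<Sum>j<n. \<bar>v j - p j\<bar>) > 0"
  shows "2 * r \<le> (\<Sum>i<n. \<bar>push n p r 1 v i - p i\<bar>)"
proof -
  have "2 * r / (\<Sum>j<n. \<bar>v j - p j\<bar>) * (\<Sum>j<n. \<bar>v j - p j\<bar>)
      \<le> max 1 (2 * r / (\<Sum>j<n. \<bar>v j - p j\<bar>)) * (\<Sum>j<n. \<bar>v j - p j\<bar>)"
    using assms by (intro mult_right_mono) auto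
  then show ?thesis
    using assms by (simp add: push_dist_center)
qed

text \<open>The isomorphism is demanded at every point of \<open>U\<close>, not just at a centre, so
  that one class over \<open>U\<close> can be followed along any path in \<open>U\<close>.\<close>

definition simple_nbhd :: "nat \<Rightarrow> 'a topology \<Rightarrow> 'a set \<Rightarrow> bool" where
  "simple_nbhd n M U \<longleftrightarrow> openin M U \<and>
     (\<forall>y\<in>U. hom_induced (int n) M (topspace M - U) M (topspace M - {y}) id
        \<in> iso (relative_homology_group (int n) M (topspace M - U))
              (relative_homology_group (int n) M (topspace M - {y})))"

text \<open>The push is centred at the image of the chosen point \<open>y\<close>, not at
  \<open>a\<close>, so a single ball serves all its points. It clears the ball of radius
  \<open>r\<close> because \<open>2 * r\<close> exceeds \<open>r\<close> plus the distance from
  \<open>p\<close> to \<open>a\<close>.\<close>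

lemma simple_coordinate_ball:
  fixes M :: "'a topology" and \<phi> :: "'a \<Rightarrow> nat \<Rightarrow> real"
  assumes M: "Hausdorff_space M" and W: "openin M W" and V: "openin (Euclidean_space n) V"
    and chart: "homeomorphic_maps (subtopology M W) (subtopology (Euclidean_space n) V) \<phi> \<psi>"
    and a: "a \<in> topspace (Euclidean_space n)" and r: "r > 0"
    and ball: "\<And>v. v \<in> topspace (Euclidean_space n) \<Longrightarrow> (\<Sum>i<n. \<bar>v i - a i\<bar>) \<le> 3 * r \<Longrightarrow> v \<in> V"
  shows "simple_nbhd n M {z \<in> W. (\<Sum>i<n. \<bar>\<phi> z i - a i\<bar>) < r}"
proof -
  let ?E = "Euclidean_space n"
  let ?N = "\<lambda>u w :: nat \<Rightarrow> real. \<Sum>i<n. \<bar>u i - w i\<bar>"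
  let ?U = "{z \<in> W. ?N (\<phi> z) a < r}"
  have WM: "W \<subseteq> topspace M" and VE: "V \<subseteq> topspace ?E"
    using W V openin_subset by auto
  have \<phi>: "continuous_map (subtopology M W) (subtopology ?E V) \<phi>"
    and \<psi>: "continuous_map (subtopology ?E V) (subtopology M W) \<psi>"
    and \<psi>\<phi>: "\<And>z. z \<in> W \<Longrightarrow> \<psi> (\<phi> z) = z" and \<phi>\<psi>: "\<And>v. v \<in> V \<Longrightarrow> \<phi> (\<psi> v) = v"
    using chart WM VE unfolding homeomorphic_maps_def by auto
  have \<phi>V: "\<phi> z \<in> V" if "z \<in> W" for z
    using continuous_map_image_subset_topspace [OF \<phi>] WM that by auto
  have \<psi>W: "\<psi> v \<in> W" if "v \<in> V" for v
    using continuous_map_image_subset_topspace [OF \<psi>] VE that by auto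
  have tri: "?N u w \<le> ?N u v + ?N v w" for u v w
    by (rule l1_triangle)
  have sym: "?N u w = ?N w u" for u w
    by (simp add: abs_minus_commute)
  have coord: "continuous_map (subtopology M W) euclideanreal (\<lambda>z. \<phi> z i)" for i
  proof -
    have "continuous_map (subtopology M W) (powertop_real UNIV) \<phi>"
      using \<phi> unfolding Euclidean_space_def continuous_map_in_subtopology by blast
    then show ?thesis by (simp add: continuous_map_componentwise_UNIV)
  qed
  have U: "openin M ?U"
  proof -
    have "continuous_map (subtopology M W) euclideanreal (\<lambda>z. ?N (\<phi> z) a)"
      by (intro continuous_intros coord) auto
    then have "openin (subtopology M W) {z \<in> topspace (subtopology M W). ?N (\<phi> z) a \<in> {..<r}}"
      by (rule openin_continuous_map_preimage) auto
    moreover have "{z \<in> topspace (subtopology M W). ?N (\<phi> z) a \<in> {..<r}} = ?U"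
      using WM by auto
    ultimately have "openin (subtopology M W) ?U" by (simp only:)
    then show ?thesis
      using W by (rule openin_trans_full)
  qed
  \<comment> \<open>Closed in all of \<open>M\<close>, not only in \<open>W\<close>, being the image
    of a compact ball in a Hausdorff space. On its complement the deformation will be the
    identity.\<close>
  define C where "C = {z \<in> W. ?N (\<phi> z) a \<le> 3 * r}"
  have C: "closedin M C"
  proof -
    have "compactin (subtopology ?E V) {v \<in> topspace ?E. ?N v a \<le> 3 * r}"
      using compactin_l1_ball ball by (auto simp: compactin_subtopology)
    then have "compactin (subtopology M W) (\<psi> ` {v \<in> topspace ?E. ?N v a \<le> 3 * r})"
      using \<psi> image_compactin by blast
    moreover have "\<psi> ` {v \<in> topspace ?E. ?N v a \<le> 3 * r} = C"
    proof
      show "\<psi> ` {v \<in> topspace ?E. ?N v a \<le> 3 * r} \<subseteq> C"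
        using ball \<psi>W \<phi>\<psi> by (auto simp: C_def)
      show "C \<subseteq> \<psi> ` {v \<in> topspace ?E. ?N v a \<le> 3 * r}"
      proof
        fix z assume "z \<in> C"
        then have "\<phi> z \<in> {v \<in> topspace ?E. ?N v a \<le> 3 * r}" "z = \<psi> (\<phi> z)"
          using \<phi>V VE \<psi>\<phi> by (auto simp: C_def)
        then show "z \<in> \<psi> ` {v \<in> topspace ?E. ?N v a \<le> 3 * r}" by blast
      qed
    qed
    ultimately have "compactin M C"
      by (simp add: compactin_subtopology)
    then show ?thesis
      using M compactin_imp_closedin by blast
  qed
  show ?thesis
    unfolding simple_nbhd_def
  proof (intro conjI ballI U)
    fix y assume y: "y \<in> ?U"
    define p where "p = \<phi> y"
    let ?S = "topspace M - {y}" and ?T = "topspace M - ?U"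
    let ?I = "top_of_set {0..1::real}"
    \<comment> \<open>Continuity across the boundary of \<open>W\<close> is not built into this
      formula; it comes from the push being already the identity on \<open>W - C\<close>.\<close>
    define h where "h = (\<lambda>(s, z). if z \<in> W then \<psi> (push n p r s (\<phi> z)) else z)"
    have p: "p \<in> V" "p \<in> topspace ?E" "?N p a < r"
      using y \<phi>V VE by (auto simp: p_def)
    \<comment> \<open>Distance 0 controls only the first \<open>n\<close> coordinates; the others
      vanish on the model space, and injectivity of the chart then gives
      \<open>z = y\<close>.\<close>
    have pos: "?N (\<phi> z) p > 0" if "z \<in> W" "z \<noteq> y" for z
    proof (rule ccontr)
      assume "\<not> ?N (\<phi> z) p > 0"
      then have "?N (\<phi> z) p = 0"
        by (meson abs_ge_zero sum_nonneg order_antisym not_less)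
      then have "\<And>i. i < n \<Longrightarrow> \<phi> z i = p i"
        by (simp add: sum_nonneg_eq_0_iff)
      moreover have "\<And>i. i \<ge> n \<Longrightarrow> \<phi> z i = p i"
        using \<phi>V [OF that(1)] VE p(2) by (auto simp: topspace_Euclidean_space)
      ultimately have "\<phi> z = p"
        by (meson ext not_less)
      then show False
        using \<psi>\<phi> [OF that(1)] \<psi>\<phi> [of y] y that(2) by (simp add: p_def)
    qed
    have push: "push n p r s (\<phi> z) \<in> V" "push n p r s (\<phi> z) \<noteq> p"
      if z: "z \<in> W" "z \<noteq> y" and s: "s \<in> {0..1}" for s z
    proof -
      have E: "push n p r s (\<phi> z) \<in> topspace ?E"
        using push_Euclidean p(2) \<phi>V [OF z(1)] VE by blast
      show "push n p r s (\<phi> z) \<in> V"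
      proof (cases "?N (\<phi> z) p < 2 * r")
        case True
        have "?N (push n p r s (\<phi> z)) a \<le> 3 * r"
          using tri [of "push n p r s (\<phi> z)" a p] push_near [OF s True pos [OF z]] p(3) by linarith
        then show ?thesis using ball E by blast
      next
        case False
        then show ?thesis
          using push_far [OF _ pos [OF z], of r s] \<phi>V [OF z(1)] by simp
      qed
      have "0 < ?N (push n p r s (\<phi> z)) p"
        using push_ge_dist [OF s, where p = p and v = "\<phi> z" and n = n and r = r] pos [OF z] by linarith
      then show "push n p r s (\<phi> z) \<noteq> p" by auto
    qed
    have outside: "h (s, z) = z" if "z \<in> topspace M - C" "z \<noteq> y" "s \<in> {0..1}" for s z
    proof (cases "z \<in> W")
      case True
      then have "?N (\<phi> z) a > 3 * r"
        using that(1) by (auto simp: C_def)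
      then have "?N (\<phi> z) p \<ge> 2 * r"
        using tri [of "\<phi> z" a p] p(3) by linarith
      then show ?thesis
        using push_far [OF _ pos [OF True that(2)]] \<psi>\<phi> True by (simp add: h_def)
    qed (simp add: h_def)
    have hS: "h (s, z) \<in> ?S" if "z \<in> ?S" "s \<in> {0..1}" for s z
    proof (cases "z \<in> W")
      case True
      then have g: "push n p r s (\<phi> z) \<in> V" "push n p r s (\<phi> z) \<noteq> p"
        using push that by auto
      then have "\<psi> (push n p r s (\<phi> z)) \<noteq> y"
        using \<phi>\<psi> [OF g(1)] by (metis p_def)
      then show ?thesis
        using g(1) \<psi>W WM True by (auto simp: h_def)
    qed (use that in \<open>simp add: h_def\<close>)
    \<comment> \<open>The two open sets cover because \<open>C\<close> lies in \<open>W\<close>, and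
      \<open>outside\<close> makes the two formulas agree where they overlap.\<close>
    have cont: "continuous_map (prod_topology ?I (subtopology M ?S)) M h"
    proof (rule pasting_lemma [where I = UNIV
          and T = "\<lambda>b. if b then {0..1} \<times> (W - {y}) else {0..1} \<times> (topspace M - C - {y})"
          and f = "\<lambda>b. if b then (\<lambda>(s, z). \<psi> (push n p r s (\<phi> z))) else snd"])
      have opS: "openin (subtopology M ?S) (A - {y})" if "openin M A" for A
        using that openin_subset [OF that] unfolding openin_subtopology by blast
      show "openin (prod_topology ?I (subtopology M ?S))
          (if b then {0..1} \<times> (W - {y}) else {0..1} \<times> (topspace M - C - {y}))" for b
        using opS [OF W] opS [OF openin_diff [OF openin_topspace C]]
        by (auto simp: openin_prod_Times_iff)
      show "continuous_map (subtopology (prod_topology ?I (subtopology M ?S))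
          (if b then {0..1} \<times> (W - {y}) else {0..1} \<times> (topspace M - C - {y}))) M
          (if b then (\<lambda>(s, z). \<psi> (push n p r s (\<phi> z))) else snd)" for b
      proof (cases b)
        case True
        let ?X = "subtopology (prod_topology ?I (subtopology M ?S)) ({0..1} \<times> (W - {y}))"
        have X: "topspace ?X = {0..1} \<times> (W - {y})"
          using WM by auto
        have c1: "continuous_map ?X euclideanreal fst"
          using continuous_map_fst continuous_map_from_subtopology continuous_map_into_fulltopology by blast
        have "continuous_map ?X (subtopology M W) snd"
          unfolding continuous_map_in_subtopology
          using continuous_map_from_subtopology [OF continuous_map_into_fulltopology [OF continuous_map_snd]]
          by (auto simp: image_subset_iff)
        then have c2: "continuous_map ?X euclideanreal (\<lambda>q. \<phi> (snd q) i)" for i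
          using continuous_map_compose [OF _ coord [of i]] by (fastforce simp: comp_def)
        \<comment> \<open>\<open>push\<close> divides by this distance, so its continuity depends on
          \<open>y\<close> having been removed.\<close>
        have ne: "?N (\<phi> (snd q)) p \<noteq> 0" if "q \<in> topspace ?X" for q
          using pos [of "snd q"] that unfolding X by fastforce
        have "continuous_map ?X euclideanreal (\<lambda>q. push n p r (fst q) (\<phi> (snd q)) i)" for i
          unfolding push_def by (intro continuous_intros c1 c2 ne) auto
        then have "continuous_map ?X (powertop_real UNIV) (\<lambda>q. push n p r (fst q) (\<phi> (snd q)))"
          by (simp add: continuous_map_componentwise_UNIV)
        then have "continuous_map ?X (subtopology ?E V) (\<lambda>q. push n p r (fst q) (\<phi> (snd q)))"
          unfolding Euclidean_space_def continuous_map_in_subtopology X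
          using push VE by (force simp: topspace_Euclidean_space)
        then have "continuous_map ?X (subtopology M W) (\<psi> \<circ> (\<lambda>q. push n p r (fst q) (\<phi> (snd q))))"
          using \<psi> by (rule continuous_map_compose)
        then have "continuous_map ?X M (\<psi> \<circ> (\<lambda>q. push n p r (fst q) (\<phi> (snd q))))"
          by (rule continuous_map_into_fulltopology)
        then show ?thesis
          using True by (simp add: comp_def case_prod_unfold)
      next
        case False
        then show ?thesis
          using continuous_map_from_subtopology [OF continuous_map_into_fulltopology [OF continuous_map_snd]]
          by simp
      qed
    next
      fix i j q
      assume "q \<in> topspace (prod_topology ?I (subtopology M ?S))
          \<inter> (if i then {0..1} \<times> (W - {y}) else {0..1} \<times> (topspace M - C - {y}))
          \<inter> (if j then {0..1} \<times> (W - {y}) else {0..1} \<times> (topspace M - C - {y}))"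
      then show "(if i then (\<lambda>(s, z). \<psi> (push n p r s (\<phi> z))) else snd) q
          = (if j then (\<lambda>(s, z). \<psi> (push n p r s (\<phi> z))) else snd) q"
        using outside [of "snd q" "fst q"]
        by (cases q) (auto simp: h_def split: if_splits)
    next
      fix q assume q: "q \<in> topspace (prod_topology ?I (subtopology M ?S))"
      show "\<exists>j. j \<in> UNIV \<and> q \<in> (if j then {0..1} \<times> (W - {y}) else {0..1} \<times> (topspace M - C - {y}))
          \<and> h q = (if j then (\<lambda>(s, z). \<psi> (push n p r s (\<phi> z))) else snd) q"
      proof (cases "snd q \<in> W")
        case True
        then show ?thesis using q by (intro exI [of _ True]) (auto simp: h_def)
      next
        case False
        then show ?thesis using q by (intro exI [of _ False]) (auto simp: h_def C_def)
      qed
    qed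
    show "hom_induced (int n) M ?T M ?S id
        \<in> iso (relative_homology_group (int n) M ?T) (relative_homology_group (int n) M ?S)"
    proof (rule restriction_bij_if_deformation [where h = h])
      show "?T \<subseteq> ?S" using y by auto
      show "continuous_map (prod_topology ?I (subtopology M ?S)) (subtopology M ?S) h"
        unfolding continuous_map_in_subtopology
      proof (intro conjI cont subsetI funcsetI)
        fix q assume "q \<in> topspace (prod_topology ?I (subtopology M ?S))"
        then obtain s z where "q = (s, z)" "s \<in> {0..1}" "z \<in> ?S"
          by (cases q) auto
        then show "h q \<in> ?S"
          using hS by blast
      qed
      show "h (0, z) = z" for z
        using \<psi>\<phi> by (simp add: h_def)
      show "h (1, z) \<in> ?T" if z: "z \<in> topspace M \<inter> ?S" for z
      proof (cases "z \<in> W")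
        case True
        then have zy: "z \<in> W" "z \<noteq> y" using z by auto
        have "2 * r \<le> ?N (push n p r 1 (\<phi> z)) p"
          using push_1_far [OF pos [OF zy]] .
        also have "\<dots> \<le> ?N (push n p r 1 (\<phi> z)) a + ?N p a"
          using tri [of "push n p r 1 (\<phi> z)" p a] sym [of a p] by linarith
        finally have "\<not> ?N (push n p r 1 (\<phi> z)) a < r"
          using p(3) by linarith
        moreover have "push n p r 1 (\<phi> z) \<in> V"
          using push(1) [OF zy] by simp
        ultimately show ?thesis
          using True \<phi>\<psi> \<psi>W WM by (auto simp: h_def)
      qed (use z in \<open>simp add: h_def\<close>)
      \<comment> \<open>Points of \<open>?T\<close> close to \<open>y\<close> do move, but along
        rays that lead away from the ball.\<close>
      show "h (s, z) \<in> ?T" if s: "s \<in> {0..1}" and z: "z \<in> topspace M \<inter> ?T" for s z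
      proof (cases "z \<in> W")
        case True
        then have zy: "z \<in> W" "z \<noteq> y" using z y by auto
        have "?N (push n p r s (\<phi> z)) a \<ge> r"
          using push_outside_ball [OF s p(3)] z True by auto
        then show ?thesis
          using push(1) [OF zy s] True \<phi>\<psi> \<psi>W WM by (auto simp: h_def)
      qed (use z in \<open>simp add: h_def\<close>)
    qed
  qed
qed

lemma topological_manifold_chart:
  assumes "topological_manifold n M" "x \<in> topspace M"
  obtains W V \<phi> \<psi> where "openin M W" "x \<in> W" "openin (Euclidean_space n) V"
    "homeomorphic_maps (subtopology M W) (subtopology (Euclidean_space n) V) \<phi> \<psi>"
  using assms unfolding topological_manifold_def homeomorphic_space_def by metis

section \<open>Locally consistent families of local orientations\<close>

text \<open>The local clause of a translation for one fixed pair of \<open>U\<close> and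
  \<open>\<beta>\<close>. With the pair explicit, the domain, the family or the parametrisation can
  be changed while the class is kept.\<close>

definition represents ::
    "nat \<Rightarrow> 'a topology \<Rightarrow> ('c::metric_space \<Rightarrow> 'a) \<Rightarrow> 'c set \<Rightarrow> ('c \<Rightarrow> 'a chain set)
       \<Rightarrow> 'c \<Rightarrow> 'a set \<Rightarrow> 'a chain set \<Rightarrow> bool" where
  "represents n M \<gamma> A \<sigma> t U \<beta> \<longleftrightarrow>
     \<beta> \<in> carrier (relative_homology_group (int n) M (topspace M - U)) \<and>
     (\<exists>e>0. \<forall>s \<in> A. dist s t < e \<longrightarrow> \<gamma> s \<in> U \<and>
        hom_induced (int n) M (topspace M - U) M (topspace M - {\<gamma> s}) id \<beta> = \<sigma> s)"

text \<open>Translation of local orientations with an arbitrary parameter space in place of the interval;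
  squares are needed as well as intervals.\<close>

definition orientation_field ::
    "nat \<Rightarrow> 'a topology \<Rightarrow> ('c::metric_space \<Rightarrow> 'a) \<Rightarrow> 'c set \<Rightarrow> ('c \<Rightarrow> 'a chain set) \<Rightarrow> bool" where
  "orientation_field n M \<gamma> A \<sigma> \<longleftrightarrow>
     (\<forall>t \<in> A. local_orientation n M (\<gamma> t) (\<sigma> t) \<and>
       (\<exists>U \<beta>. openin M U \<and> \<gamma> t \<in> U \<and> represents n M \<gamma> A \<sigma> t U \<beta>))"

lemma orientation_translation_iff_field:
  "orientation_translation n M \<gamma> \<sigma> \<longleftrightarrow> orientation_field n M \<gamma> {0..1} \<sigma>"
  by (simp only: orientation_translation_def orientation_field_def represents_def dist_real_def ball_conj_distrib)

lemma restriction_to_point_compose: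
  assumes "V \<subseteq> U" "y \<in> V"
  shows "hom_induced p M (topspace M - V) M (topspace M - {y}) id
           (hom_induced p M (topspace M - U) M (topspace M - V) id \<beta>)
         = hom_induced p M (topspace M - U) M (topspace M - {y}) id \<beta>"
  using assms by (subst hom_induced_compose') auto

text \<open>Both directions serve: at one point of a simple neighbourhood a local orientation shows
  that the class over the neighbourhood generates, and at all other points this makes its
  restrictions local orientations.\<close>

lemma local_orientation_iso:
  assumes "h \<in> iso G (relative_homology_group (int n) M (topspace M - {x}))"
    and "group G" "b \<in> carrier G"
  shows "local_orientation n M x (h b) \<longleftrightarrow> generate G {b} = carrier G"
proof -
  let ?H = "relative_homology_group (int n) M (topspace M - {x})"
  interpret group_hom G ?H h
    using assms by (simp add: group_hom_def group_hom_axioms_def iso_def)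
  have bij: "bij_betw h (carrier G) (carrier ?H)"
    using assms(1) by (simp add: iso_def)
  have img: "h ` generate G {b} = generate ?H {h b}"
    using generate_img [of "{b}"] assms(3) by simp
  have sub: "generate G {b} \<subseteq> carrier G"
    using assms(3) G.generate_incl by simp
  have "h ` generate G {b} = h ` carrier G \<longleftrightarrow> generate G {b} = carrier G"
    using inj_on_image_eq_iff [OF bij_betw_imp_inj_on [OF bij] sub order_refl] .
  then show ?thesis
    using img bij assms(3) by (auto simp: local_orientation_def Let_def bij_betw_def)
qed

lemma represents_compose:
  fixes k :: "'d::metric_space \<Rightarrow> 'c::metric_space"
  assumes "represents n M \<gamma> A \<sigma> (k t) U \<beta>" and k: "continuous_on B k" "k ` B \<subseteq> A" and t: "t \<in> B"
  shows "represents n M (\<gamma> \<circ> k) B (\<sigma> \<circ> k) t U \<beta>"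
proof -
  obtain e where e: "e > 0" "\<forall>s \<in> A. dist s (k t) < e \<longrightarrow> \<gamma> s \<in> U \<and>
        hom_induced (int n) M (topspace M - U) M (topspace M - {\<gamma> s}) id \<beta> = \<sigma> s"
    and \<beta>: "\<beta> \<in> carrier (relative_homology_group (int n) M (topspace M - U))"
    using assms(1) unfolding represents_def by auto
  obtain d where "d > 0" "\<And>s. s \<in> B \<Longrightarrow> dist s t < d \<Longrightarrow> dist (k s) (k t) < e"
    using k(1) t \<open>e > 0\<close> unfolding continuous_on_iff by blast
  then show ?thesis
    unfolding represents_def using e \<beta> k(2) by (intro conjI exI [of _ d]) auto
qed

lemma represents_subset:
  "represents n M \<gamma> A \<sigma> t U \<beta> \<Longrightarrow> B \<subseteq> A \<Longrightarrow> represents n M \<gamma> B \<sigma> t U \<beta>"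
  unfolding represents_def by (meson subsetD)

lemma represents_cong:
  assumes "represents n M \<gamma> A \<sigma> t U \<beta>" "d > 0"
    and "\<And>s. s \<in> B \<Longrightarrow> dist s t < d \<Longrightarrow> s \<in> A \<and> \<gamma>' s = \<gamma> s \<and> \<tau> s = \<sigma> s"
  shows "represents n M \<gamma>' B \<tau> t U \<beta>"
proof -
  obtain e where "e > 0" "\<forall>s \<in> A. dist s t < e \<longrightarrow> \<gamma> s \<in> U \<and>
        hom_induced (int n) M (topspace M - U) M (topspace M - {\<gamma> s}) id \<beta> = \<sigma> s"
    and "\<beta> \<in> carrier (relative_homology_group (int n) M (topspace M - U))"
    using assms(1) unfolding represents_def by auto
  then show ?thesis
    unfolding represents_def using assms(2,3) by (intro conjI exI [of _ "min d e"]) auto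
qed

lemma represents_Un:
  assumes A: "represents n M \<gamma> A \<sigma> t U \<beta>" and B: "represents n M \<gamma> B \<sigma> t U \<beta>"
  shows "represents n M \<gamma> (A \<union> B) \<sigma> t U \<beta>"
proof -
  obtain d where "d > 0" "\<forall>s \<in> A. dist s t < d \<longrightarrow> \<gamma> s \<in> U \<and>
        hom_induced (int n) M (topspace M - U) M (topspace M - {\<gamma> s}) id \<beta> = \<sigma> s"
    using A unfolding represents_def by auto
  moreover obtain e where "e > 0" "\<forall>s \<in> B. dist s t < e \<longrightarrow> \<gamma> s \<in> U \<and>
        hom_induced (int n) M (topspace M - U) M (topspace M - {\<gamma> s}) id \<beta> = \<sigma> s"
    using B unfolding represents_def by auto
  ultimately show ?thesis
    using A unfolding represents_def by (intro conjI exI [of _ "min d e"]) auto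
qed

lemma represents_self:
  assumes "represents n M \<gamma> A \<sigma> t U \<beta>" "t \<in> A"
  shows "\<gamma> t \<in> U" "hom_induced (int n) M (topspace M - U) M (topspace M - {\<gamma> t}) id \<beta> = \<sigma> t"
  using assms unfolding represents_def by auto

lemma orientation_field_subset:
  assumes "orientation_field n M \<gamma> A \<sigma>" "B \<subseteq> A"
  shows "orientation_field n M \<gamma> B \<sigma>"
  unfolding orientation_field_def
proof
  fix t assume "t \<in> B"
  then have "t \<in> A" using assms(2) by blast
  then obtain U \<beta> where "local_orientation n M (\<gamma> t) (\<sigma> t)" "openin M U" "\<gamma> t \<in> U"
      "represents n M \<gamma> A \<sigma> t U \<beta>"
    using assms(1) unfolding orientation_field_def by blast
  then show "local_orientation n M (\<gamma> t) (\<sigma> t) \<and>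
      (\<exists>U \<beta>. openin M U \<and> \<gamma> t \<in> U \<and> represents n M \<gamma> B \<sigma> t U \<beta>)"
    using represents_subset [OF _ assms(2)] by metis
qed

lemma orientation_field_cong:
  assumes "orientation_field n M \<gamma> A \<sigma>" "\<And>t. t \<in> A \<Longrightarrow> \<gamma>' t = \<gamma> t" "\<And>t. t \<in> A \<Longrightarrow> \<tau> t = \<sigma> t"
  shows "orientation_field n M \<gamma>' A \<tau>"
  using assms unfolding orientation_field_def represents_def by simp

lemma orientation_field_compose:
  assumes "orientation_field n M \<gamma> A \<sigma>" and "continuous_on B k" "k ` B \<subseteq> A"
  shows "orientation_field n M (\<gamma> \<circ> k) B (\<sigma> \<circ> k)"
  unfolding orientation_field_def
proof
  fix t assume t: "t \<in> B"
  then have "k t \<in> A" using assms(3) by auto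
  then obtain U \<beta> where "local_orientation n M (\<gamma> (k t)) (\<sigma> (k t))"
      "openin M U" "\<gamma> (k t) \<in> U" "represents n M \<gamma> A \<sigma> (k t) U \<beta>"
    using assms(1) unfolding orientation_field_def by blast
  then show "local_orientation n M ((\<gamma> \<circ> k) t) ((\<sigma> \<circ> k) t) \<and>
      (\<exists>U \<beta>. openin M U \<and> (\<gamma> \<circ> k) t \<in> U \<and> represents n M (\<gamma> \<circ> k) B (\<sigma> \<circ> k) t U \<beta>)"
    using represents_compose [OF _ assms(2,3) t] by (metis comp_apply)
qed

lemma continuous_map_into_open:
  fixes \<gamma> :: "'c::metric_space \<Rightarrow> 'a"
  assumes "continuous_map (top_of_set A) M \<gamma>" "t \<in> A" "openin M V" "\<gamma> t \<in> V"
  obtains e where "e > 0" "\<forall>s\<in>A. dist s t < e \<longrightarrow> \<gamma> s \<in> V"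
proof -
  have "openin (top_of_set A) {s \<in> A. \<gamma> s \<in> V}"
    using openin_continuous_map_preimage [OF assms(1,3)] by simp
  then show ?thesis
    using assms(2,4) that unfolding openin_euclidean_subtopology_iff by blast
qed

lemma orientation_field_refine:
  assumes \<sigma>: "orientation_field n M \<gamma> A \<sigma>" and \<gamma>: "continuous_map (top_of_set A) M \<gamma>" and t: "t \<in> A"
  obtains U where "openin M U" "\<gamma> t \<in> U"
    "\<forall>V. openin M V \<longrightarrow> \<gamma> t \<in> V \<longrightarrow> V \<subseteq> U \<longrightarrow> (\<exists>\<beta>. represents n M \<gamma> A \<sigma> t V \<beta>)"
proof -
  obtain U \<beta> where U: "openin M U" "\<gamma> t \<in> U" "represents n M \<gamma> A \<sigma> t U \<beta>"
    using \<sigma> t unfolding orientation_field_def by blast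
  obtain e where e: "e > 0" "\<forall>s \<in> A. dist s t < e \<longrightarrow> \<gamma> s \<in> U \<and>
        hom_induced (int n) M (topspace M - U) M (topspace M - {\<gamma> s}) id \<beta> = \<sigma> s"
    using U(3) unfolding represents_def by auto
  have "\<exists>\<beta>. represents n M \<gamma> A \<sigma> t V \<beta>" if V: "openin M V" "\<gamma> t \<in> V" "V \<subseteq> U" for V
  proof -
    obtain d where d: "d > 0" "\<forall>s\<in>A. dist s t < d \<longrightarrow> \<gamma> s \<in> V"
      using continuous_map_into_open [OF \<gamma> t V(1,2)] .
    let ?\<beta> = "hom_induced (int n) M (topspace M - U) M (topspace M - V) id \<beta>"
    have "represents n M \<gamma> A \<sigma> t V ?\<beta>"
      unfolding represents_def using e d V(3)
      by (intro conjI exI [of _ "min d e"])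
        (auto simp: restriction_to_point_compose hom_induced_carrier)
    then show ?thesis by blast
  qed
  with U(1,2) show ?thesis using that by blast
qed

lemma homotopic_pathsin_iff:
  "homotopic_pathsin X p q \<longleftrightarrow>
     (\<exists>h. continuous_map (prod_topology (top_of_set {0..1::real}) (top_of_set {0..1})) X h \<and>
        (\<forall>t\<in>{0..1}. h (0, t) = p t) \<and> (\<forall>t\<in>{0..1}. h (1, t) = q t) \<and>
        (\<forall>s\<in>{0..1}. h (s, 0) = p 0 \<and> h (s, 1) = p 1))"
  unfolding homotopic_pathsin_def by (subst homotopic_with) auto

section \<open>Uniqueness and gluing of orientation fields\<close>

locale simply_based =
  fixes n :: nat and M :: "'a topology"
  assumes simple_base: "\<And>W x. openin M W \<Longrightarrow> x \<in> W \<Longrightarrow> \<exists>U. simple_nbhd n M U \<and> x \<in> U \<and> U \<subseteq> W"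
begin

lemma common_representation:
  assumes \<sigma>: "orientation_field n M \<gamma> A \<sigma>" "continuous_map (top_of_set A) M \<gamma>" "t \<in> A"
    and \<tau>: "orientation_field n M \<gamma> B \<tau>" "continuous_map (top_of_set B) M \<gamma>" "t \<in> B"
  obtains V b c where "simple_nbhd n M V" "represents n M \<gamma> A \<sigma> t V b" "represents n M \<gamma> B \<tau> t V c"
proof -
  obtain U1 where U1: "openin M U1" "\<gamma> t \<in> U1"
    "\<forall>V. openin M V \<longrightarrow> \<gamma> t \<in> V \<longrightarrow> V \<subseteq> U1 \<longrightarrow> (\<exists>\<beta>. represents n M \<gamma> A \<sigma> t V \<beta>)"
    using orientation_field_refine [OF \<sigma>] .
  obtain U2 where U2: "openin M U2" "\<gamma> t \<in> U2"
    "\<forall>V. openin M V \<longrightarrow> \<gamma> t \<in> V \<longrightarrow> V \<subseteq> U2 \<longrightarrow> (\<exists>\<beta>. represents n M \<gamma> B \<tau> t V \<beta>)"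
    using orientation_field_refine [OF \<tau>] .
  obtain V where V: "simple_nbhd n M V" "\<gamma> t \<in> V" "V \<subseteq> U1 \<inter> U2"
    using simple_base [of "U1 \<inter> U2" "\<gamma> t"] U1(1,2) U2(1,2) by blast
  then have "openin M V" by (simp add: simple_nbhd_def)
  then show ?thesis
    using that V U1(3) U2(3) by (metis le_inf_iff)
qed

lemma simple_nbhd_inj:
  assumes "simple_nbhd n M V" "y \<in> V"
    and "b \<in> carrier (relative_homology_group (int n) M (topspace M - V))"
    and "c \<in> carrier (relative_homology_group (int n) M (topspace M - V))"
  shows "hom_induced (int n) M (topspace M - V) M (topspace M - {y}) id b
       = hom_induced (int n) M (topspace M - V) M (topspace M - {y}) id c \<longleftrightarrow> b = c"
proof (rule inj_on_eq_iff [OF _ assms(3,4)])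
  show "inj_on (hom_induced (int n) M (topspace M - V) M (topspace M - {y}) id)
      (carrier (relative_homology_group (int n) M (topspace M - V)))"
    using assms(1,2) by (simp add: simple_nbhd_def iso_def bij_betw_def)
qed

text \<open>Over a common simple neighbourhood the fields come from classes \<open>b\<close> and
  \<open>c\<close>. Restriction is injective at each of its points, so agreement at any nearby
  parameter amounts to \<open>b = c\<close>, a condition that does not mention the
  parameter.\<close>

lemma fields_agree_locally:
  assumes "orientation_field n M \<gamma> A \<sigma>" and \<gamma>: "continuous_map (top_of_set A) M \<gamma>"
    and "orientation_field n M \<gamma> A \<tau>" and t: "t \<in> A"
  shows "\<exists>e>0. \<forall>s\<in>A. dist s t < e \<longrightarrow> (\<sigma> s = \<tau> s \<longleftrightarrow> \<sigma> t = \<tau> t)"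
proof -
  obtain V b c where V: "simple_nbhd n M V" and b: "represents n M \<gamma> A \<sigma> t V b"
      and c: "represents n M \<gamma> A \<tau> t V c"
    using common_representation [OF assms(1,2,4) assms(3,2,4)] .
  let ?r = "\<lambda>y. hom_induced (int n) M (topspace M - V) M (topspace M - {y}) id"
  obtain d where d: "d > 0" "\<And>s. s \<in> A \<Longrightarrow> dist s t < d \<Longrightarrow> \<gamma> s \<in> V \<and> ?r (\<gamma> s) b = \<sigma> s"
    using b unfolding represents_def by auto
  obtain e where e: "e > 0" "\<And>s. s \<in> A \<Longrightarrow> dist s t < e \<Longrightarrow> \<gamma> s \<in> V \<and> ?r (\<gamma> s) c = \<tau> s"
    using c unfolding represents_def by auto
  have bc: "b \<in> carrier (relative_homology_group (int n) M (topspace M - V))"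
      "c \<in> carrier (relative_homology_group (int n) M (topspace M - V))"
    using b c unfolding represents_def by auto
  have *: "\<sigma> s = \<tau> s \<longleftrightarrow> b = c" if "s \<in> A" "dist s t < min d e" for s
    using d(2) [of s] e(2) [of s] simple_nbhd_inj [OF V _ bc, of "\<gamma> s"] that by auto
  show ?thesis
    using d(1) e(1) t * [of t] * by (intro exI [of _ "min d e"]) auto
qed

lemma fields_eq_on_connected:
  assumes \<sigma>: "orientation_field n M \<gamma> A \<sigma>" and \<gamma>: "continuous_map (top_of_set A) M \<gamma>"
    and \<tau>: "orientation_field n M \<gamma> A \<tau>" and A: "connected A"
    and q: "q \<in> A" "\<sigma> q = \<tau> q" and t: "t \<in> A"
  shows "\<sigma> t = \<tau> t"
proof -
  \<comment> \<open>Both truth values at once: \<open>P\<close> true treats the set of agreement,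
    \<open>P\<close> false its complement in \<open>A\<close>.\<close>
  have op: "openin (top_of_set A) {t \<in> A. (\<sigma> t = \<tau> t) = P}" for P
    unfolding openin_euclidean_subtopology_iff
  proof (intro conjI ballI)
    fix x assume "x \<in> {t \<in> A. (\<sigma> t = \<tau> t) = P}"
    then have x: "x \<in> A" "(\<sigma> x = \<tau> x) = P" by auto
    obtain e where "e > 0" "\<forall>s\<in>A. dist s x < e \<longrightarrow> (\<sigma> s = \<tau> s \<longleftrightarrow> \<sigma> x = \<tau> x)"
      using fields_agree_locally [OF \<sigma> \<gamma> \<tau> x(1)] by blast
    then show "\<exists>e>0. \<forall>y\<in>A. dist y x < e \<longrightarrow> y \<in> {t \<in> A. (\<sigma> t = \<tau> t) = P}"
      using x(2) by (intro exI [of _ e]) simp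
  qed blast
  have "A - {t \<in> A. (\<sigma> t = \<tau> t) = True} = {t \<in> A. (\<sigma> t = \<tau> t) = False}"
    by auto
  then have "closedin (top_of_set A) {t \<in> A. (\<sigma> t = \<tau> t) = True}"
    using op [of False] by (simp add: closedin_def)
  then have "{t \<in> A. (\<sigma> t = \<tau> t) = True} = {} \<or> {t \<in> A. (\<sigma> t = \<tau> t) = True} = A"
    using A op [of True] unfolding connected_clopen by blast
  then show ?thesis
    using q t by auto
qed

text \<open>Where only one piece is present, closedness of the other keeps it away. At a common
  point the two classes over a shared simple neighbourhood have the same restriction to that point,
  hence are equal, and this one class represents both sides.\<close>

lemma orientation_field_glue:
  assumes \<sigma>: "orientation_field n M \<gamma> A \<sigma>" and \<tau>: "orientation_field n M \<gamma> B \<tau>"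
    and \<gamma>: "continuous_map (top_of_set (A \<union> B)) M \<gamma>" and cl: "closed A" "closed B"
    and eq: "\<And>t. t \<in> A \<inter> B \<Longrightarrow> \<sigma> t = \<tau> t"
  shows "orientation_field n M \<gamma> (A \<union> B) (\<lambda>t. if t \<in> A then \<sigma> t else \<tau> t)"
  unfolding orientation_field_def
proof
  fix t assume t: "t \<in> A \<union> B"
  let ?\<rho> = "\<lambda>t. if t \<in> A then \<sigma> t else \<tau> t"
  have \<gamma>AB: "continuous_map (top_of_set A) M \<gamma>" "continuous_map (top_of_set B) M \<gamma>"
    using continuous_map_from_subtopology_mono [OF \<gamma>] by auto
  have away: "\<exists>d>0. \<forall>s. dist s t < d \<longrightarrow> s \<notin> C" if "closed C" "t \<notin> C" for C
    using that by (meson closed_def open_dist ComplD ComplI)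
  have "\<exists>U \<beta>. openin M U \<and> \<gamma> t \<in> U \<and> represents n M \<gamma> (A \<union> B) ?\<rho> t U \<beta>"
  proof -
    consider "t \<in> A" "t \<notin> B" | "t \<notin> A" "t \<in> B" | "t \<in> A" "t \<in> B" using t by blast
    then show ?thesis
    proof cases
      case 1
      obtain d where d: "d > 0" "\<And>s. dist s t < d \<Longrightarrow> s \<notin> B"
        using away [OF cl(2) 1(2)] by blast
      obtain U \<beta> where U: "openin M U" "\<gamma> t \<in> U" "represents n M \<gamma> A \<sigma> t U \<beta>"
        using \<sigma> 1(1) unfolding orientation_field_def by blast
      have "represents n M \<gamma> (A \<union> B) ?\<rho> t U \<beta>"
        by (rule represents_cong [OF U(3) d(1)]) (use d(2) in auto)
      with U show ?thesis by blast
    next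
      case 2
      obtain d where d: "d > 0" "\<And>s. dist s t < d \<Longrightarrow> s \<notin> A"
        using away [OF cl(1) 2(1)] by blast
      obtain U \<beta> where U: "openin M U" "\<gamma> t \<in> U" "represents n M \<gamma> B \<tau> t U \<beta>"
        using \<tau> 2(2) unfolding orientation_field_def by blast
      have "represents n M \<gamma> (A \<union> B) ?\<rho> t U \<beta>"
        by (rule represents_cong [OF U(3) d(1)]) (use d(2) in auto)
      with U show ?thesis by blast
    next
      case 3
      obtain V b c where V: "simple_nbhd n M V" and b: "represents n M \<gamma> A \<sigma> t V b"
          and c: "represents n M \<gamma> B \<tau> t V c"
        using common_representation [OF \<sigma> \<gamma>AB(1) 3(1) \<tau> \<gamma>AB(2) 3(2)] .
      have bc: "b \<in> carrier (relative_homology_group (int n) M (topspace M - V))"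
          "c \<in> carrier (relative_homology_group (int n) M (topspace M - V))"
        using b c unfolding represents_def by auto
      have "b = c"
        using simple_nbhd_inj [OF V represents_self(1) [OF b 3(1)] bc]
          represents_self(2) [OF b 3(1)] represents_self(2) [OF c 3(2)] eq 3 by auto
      have "represents n M \<gamma> A ?\<rho> t V b"
        by (rule represents_cong [OF b zero_less_one]) simp
      moreover have "represents n M \<gamma> B ?\<rho> t V b"
        unfolding \<open>b = c\<close> by (rule represents_cong [OF c zero_less_one]) (simp add: eq)
      ultimately have "represents n M \<gamma> (A \<union> B) ?\<rho> t V b"
        by (rule represents_Un)
      then show ?thesis
        using V represents_self(1) [OF b 3(1)] unfolding simple_nbhd_def by blast
    qed
  qed
  moreover have "local_orientation n M (\<gamma> t) (?\<rho> t)"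
    using \<sigma> \<tau> t unfolding orientation_field_def by (cases "t \<in> A") auto
  ultimately show "local_orientation n M (\<gamma> t) (?\<rho> t) \<and>
      (\<exists>U \<beta>. openin M U \<and> \<gamma> t \<in> U \<and> represents n M \<gamma> (A \<union> B) ?\<rho> t U \<beta>)"
    by blast
qed

section \<open>Existence of orientation fields over intervals and squares\<close>

lemma simple_nbhd_field:
  assumes U: "simple_nbhd n M U" and x: "x \<in> U" and \<mu>: "local_orientation n M x \<mu>"
  obtains b where "hom_induced (int n) M (topspace M - U) M (topspace M - {x}) id b = \<mu>"
    and "\<And>(\<gamma> :: 'c::metric_space \<Rightarrow> 'a) A. \<gamma> ` A \<subseteq> U \<Longrightarrow> orientation_field n M \<gamma> A
           (\<lambda>t. hom_induced (int n) M (topspace M - U) M (topspace M - {\<gamma> t}) id b)"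
proof -
  let ?G = "relative_homology_group (int n) M (topspace M - U)"
  let ?r = "\<lambda>y. hom_induced (int n) M (topspace M - U) M (topspace M - {y}) id"
  have iso: "?r y \<in> iso ?G (relative_homology_group (int n) M (topspace M - {y}))" if "y \<in> U" for y
    using U that by (simp add: simple_nbhd_def)
  have "\<mu> \<in> carrier (relative_homology_group (int n) M (topspace M - {x}))"
    using \<mu> by (simp add: local_orientation_def Let_def)
  then obtain b where b: "b \<in> carrier ?G" "?r x b = \<mu>"
    using iso [OF x] unfolding iso_def bij_betw_def by (smt (verit) imageE mem_Collect_eq)
  \<comment> \<open>Generation is read off at \<open>x\<close> and then passed on to every other
    point of \<open>U\<close> through the isomorphism there.\<close>
  have gen: "generate ?G {b} = carrier ?G"
    using local_orientation_iso [OF iso [OF x] _ b(1)] \<mu> b(2) by simp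
  have "orientation_field n M \<gamma> A (\<lambda>t. ?r (\<gamma> t) b)" if "\<gamma> ` A \<subseteq> U" for \<gamma> :: "'c \<Rightarrow> 'a" and A
    unfolding orientation_field_def
  proof
    fix t assume t: "t \<in> A"
    then have y: "\<gamma> t \<in> U" using that by auto
    have "represents n M \<gamma> A (\<lambda>t. ?r (\<gamma> t) b) t U b"
      unfolding represents_def using b(1) that by (intro conjI exI [of _ 1]) auto
    moreover have "local_orientation n M (\<gamma> t) (?r (\<gamma> t) b)"
      using local_orientation_iso [OF iso [OF y] _ b(1)] gen by simp
    moreover have "openin M U"
      using U by (simp add: simple_nbhd_def)
    ultimately show "local_orientation n M (\<gamma> t) (?r (\<gamma> t) b) \<and>
       (\<exists>U \<beta>. openin M U \<and> \<gamma> t \<in> U \<and> represents n M \<gamma> A (\<lambda>t. ?r (\<gamma> t) b) t U \<beta>)"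
      using y by blast
  qed
  then show ?thesis using that b(2) by blast
qed

text \<open>The value may be prescribed at any point of \<open>A\<close> instead of a base point, so
  that an extension can start at whichever point a neighbouring piece shares.\<close>

definition liftable :: "('c::metric_space \<Rightarrow> 'a) \<Rightarrow> 'c set \<Rightarrow> bool" where
  "liftable \<gamma> A \<longleftrightarrow> (\<forall>q\<in>A. \<forall>\<mu>. local_orientation n M (\<gamma> q) \<mu> \<longrightarrow>
     (\<exists>\<sigma>. orientation_field n M \<gamma> A \<sigma> \<and> \<sigma> q = \<mu>))"

lemma liftableD:
  assumes "liftable \<gamma> A" "q \<in> A" "local_orientation n M (\<gamma> q) \<mu>"
  obtains \<sigma> where "orientation_field n M \<gamma> A \<sigma>" "\<sigma> q = \<mu>"
  using assms unfolding liftable_def by blast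

lemma liftable_near:
  assumes "continuous_map (top_of_set S) M \<gamma>" "t \<in> S"
  obtains e where "e > 0" "\<forall>A. A \<subseteq> S \<longrightarrow> A \<subseteq> ball t e \<longrightarrow> liftable \<gamma> A"
proof -
  have "\<gamma> t \<in> topspace M"
    using assms by (auto simp: continuous_map_def)
  then obtain U where U: "simple_nbhd n M U" "\<gamma> t \<in> U"
    using simple_base [OF openin_topspace] by blast
  then have "openin M U" by (simp add: simple_nbhd_def)
  then obtain e where e: "e > 0" "\<forall>s\<in>S. dist s t < e \<longrightarrow> \<gamma> s \<in> U"
    using continuous_map_into_open [OF assms _ U(2)] by blast
  have "liftable \<gamma> A" if "A \<subseteq> S" "A \<subseteq> ball t e" for A
    unfolding liftable_def
  proof (intro ballI allI impI)
    fix q \<mu> assume q: "q \<in> A" and \<mu>: "local_orientation n M (\<gamma> q) \<mu>"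
    have A: "\<gamma> ` A \<subseteq> U"
      using e(2) that by (auto simp: dist_commute subset_iff)
    then have "\<gamma> q \<in> U" using q by auto
    then show "\<exists>\<sigma>. orientation_field n M \<gamma> A \<sigma> \<and> \<sigma> q = \<mu>"
      using simple_nbhd_field [OF U(1) _ \<mu>] A by metis
  qed
  with e(1) show ?thesis using that by blast
qed

text \<open>A field on one piece prescribes a value at one common point, and the other piece is
  lifted from there. Connectedness of the intersection turns agreement at that point into agreement
  on all of it, as gluing requires.\<close>

lemma liftable_Un:
  assumes \<gamma>: "continuous_map (top_of_set (A \<union> B)) M \<gamma>" and cl: "closed A" "closed B"
    and conn: "connected (A \<inter> B)" and ne: "A \<inter> B \<noteq> {}"
    and lift: "liftable \<gamma> A" "liftable \<gamma> B"
  shows "liftable \<gamma> (A \<union> B)"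
proof -
  \<comment> \<open>\<open>A\<close> and \<open>B\<close> are quantified afresh so that their roles
    can be exchanged when \<open>q\<close> lies in \<open>B\<close>.\<close>
  have *: "\<exists>\<sigma>. orientation_field n M \<gamma> (A \<union> B) \<sigma> \<and> \<sigma> q = \<mu>"
    if \<gamma>: "continuous_map (top_of_set (A \<union> B)) M \<gamma>" and cl: "closed A" "closed B"
      and conn: "connected (A \<inter> B)" and ne: "A \<inter> B \<noteq> {}"
      and lift: "liftable \<gamma> A" "liftable \<gamma> B"
      and q: "q \<in> A" and \<mu>: "local_orientation n M (\<gamma> q) \<mu>" for A B q \<mu>
  proof -
    obtain \<sigma> where \<sigma>: "orientation_field n M \<gamma> A \<sigma>" "\<sigma> q = \<mu>"
      using liftableD [OF lift(1) q \<mu>] .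
    obtain r where r: "r \<in> A \<inter> B" using ne by blast
    then have "local_orientation n M (\<gamma> r) (\<sigma> r)"
      using \<sigma>(1) unfolding orientation_field_def by blast
    then obtain \<tau> where \<tau>: "orientation_field n M \<gamma> B \<tau>" "\<tau> r = \<sigma> r"
      using liftableD [OF lift(2)] r by blast
    have \<gamma>AB: "continuous_map (top_of_set (A \<inter> B)) M \<gamma>"
      using continuous_map_from_subtopology_mono [OF \<gamma>] by auto
    have "\<sigma> t = \<tau> t" if "t \<in> A \<inter> B" for t
      using fields_eq_on_connected [OF orientation_field_subset [OF \<sigma>(1)] \<gamma>AB
          orientation_field_subset [OF \<tau>(1)] conn r _ that] \<tau>(2) by simp
    then have "orientation_field n M \<gamma> (A \<union> B) (\<lambda>t. if t \<in> A then \<sigma> t else \<tau> t)"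
      by (rule orientation_field_glue [OF \<sigma>(1) \<tau>(1) \<gamma> cl])
    then show ?thesis
      using q \<sigma>(2) by (intro exI [of _ "\<lambda>t. if t \<in> A then \<sigma> t else \<tau> t"]) simp
  qed
  show ?thesis
    unfolding liftable_def
  proof (intro ballI allI impI)
    fix q \<mu> assume "q \<in> A \<union> B" and \<mu>: "local_orientation n M (\<gamma> q) \<mu>"
    then consider "q \<in> A" | "q \<in> B" by blast
    then show "\<exists>\<sigma>. orientation_field n M \<gamma> (A \<union> B) \<sigma> \<and> \<sigma> q = \<mu>"
    proof cases
      case 1 then show ?thesis using * [OF assms 1 \<mu>] by simp
    next
      case 2
      have "\<exists>\<sigma>. orientation_field n M \<gamma> (B \<union> A) \<sigma> \<and> \<sigma> q = \<mu>"
        by (rule * [OF _ cl(2,1) _ _ lift(2,1) 2 \<mu>])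
          (use \<gamma> conn ne in \<open>simp_all add: Un_commute Int_commute\<close>)
      then show ?thesis by (simp add: Un_commute)
    qed
  qed
qed

text \<open>Bisection in each coordinate in place of a Lebesgue number: \<open>Bolzano\<close>
  extends a property of intervals to \<open>{0..1}\<close> if it is additive and holds for all short
  intervals around each point. Rectangles are stacked into thin strips around each \<open>s\<close>,
  then strips into the square; neighbouring pieces meet in a segment, which is connected.\<close>

lemma liftable_square:
  fixes \<gamma> :: "real \<times> real \<Rightarrow> 'a"
  assumes \<gamma>: "continuous_map (top_of_set ({0..1} \<times> {0..1})) M \<gamma>"
  shows "liftable \<gamma> ({0..1} \<times> {0..1})"
proof -
  have cont: "continuous_map (top_of_set A) M \<gamma>" if "A \<subseteq> {0..1} \<times> {0..1}" for A
    using continuous_map_from_subtopology_mono [OF \<gamma> that] .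
  have strip: "\<exists>d>0. \<forall>a b. 0 \<le> a \<and> a \<le> s \<and> s \<le> b \<and> b \<le> 1 \<and> b - a < d \<longrightarrow> liftable \<gamma> ({a..b} \<times> {0..1})"
    if s: "s \<in> {0..1}" for s
  proof -
    \<comment> \<open>The premises make \<open>Q\<close> vacuous on intervals that stick out of
      \<open>{0..1}\<close>, which \<open>Bolzano\<close> also considers around an end point. The
      width \<open>d\<close> is existential inside \<open>Q\<close> because stacking two rectangles
      replaces it by a minimum.\<close>
    define Q where "Q u v \<longleftrightarrow> (0 \<le> u \<longrightarrow> u \<le> v \<longrightarrow> v \<le> 1 \<longrightarrow>
      (\<exists>d>0. \<forall>a b. 0 \<le> a \<and> a \<le> s \<and> s \<le> b \<and> b \<le> 1 \<and> b - a < d \<longrightarrow> liftable \<gamma> ({a..b} \<times> {u..v})))" for u v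
    have "Q 0 1"
    proof (rule Bolzano [OF zero_le_one])
      fix u v w assume trans: "Q u v" "Q v w" "u \<le> v" "v \<le> w"
      show "Q u w"
        unfolding Q_def
      proof (intro impI)
        assume "0 \<le> u" "w \<le> 1"
        obtain d1 where d1: "d1 > 0"
          "\<forall>a b. 0 \<le> a \<and> a \<le> s \<and> s \<le> b \<and> b \<le> 1 \<and> b - a < d1 \<longrightarrow> liftable \<gamma> ({a..b} \<times> {u..v})"
          using trans \<open>0 \<le> u\<close> \<open>w \<le> 1\<close> unfolding Q_def by auto
        obtain d2 where d2: "d2 > 0"
          "\<forall>a b. 0 \<le> a \<and> a \<le> s \<and> s \<le> b \<and> b \<le> 1 \<and> b - a < d2 \<longrightarrow> liftable \<gamma> ({a..b} \<times> {v..w})"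
          using trans \<open>0 \<le> u\<close> \<open>w \<le> 1\<close> unfolding Q_def by auto
        have "liftable \<gamma> ({a..b} \<times> {u..w})"
          if "0 \<le> a \<and> a \<le> s \<and> s \<le> b \<and> b \<le> 1 \<and> b - a < min d1 d2" for a b
        proof -
          have eq: "{a..b} \<times> {u..w} = {a..b} \<times> {u..v} \<union> {a..b} \<times> {v..w}"
            using trans(3,4) by auto
          have int: "({a..b} \<times> {u..v}) \<inter> ({a..b} \<times> {v..w}) = {a..b} \<times> {v..v}"
            using trans(3,4) by auto
          show ?thesis
            unfolding eq
          proof (rule liftable_Un)
            show "continuous_map (top_of_set ({a..b} \<times> {u..v} \<union> {a..b} \<times> {v..w})) M \<gamma>"
              using cont [of "{a..b} \<times> {u..w}"] that \<open>0 \<le> u\<close> \<open>w \<le> 1\<close> unfolding eq [symmetric] by fastforce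
            show "connected (({a..b} \<times> {u..v}) \<inter> ({a..b} \<times> {v..w}))"
              unfolding int by (intro convex_connected convex_Times convex_real_interval)
            show "({a..b} \<times> {u..v}) \<inter> ({a..b} \<times> {v..w}) \<noteq> {}"
              unfolding int using that by auto
          qed (use d1 d2 that in \<open>auto intro!: closed_Times\<close>)
        qed
        then show "\<exists>d>0. \<forall>a b. 0 \<le> a \<and> a \<le> s \<and> s \<le> b \<and> b \<le> 1 \<and> b - a < d \<longrightarrow> liftable \<gamma> ({a..b} \<times> {u..w})"
          using d1(1) d2(1) by (intro exI [of _ "min d1 d2"]) auto
      qed
    next
      fix t :: real assume "0 \<le> t" "t \<le> 1"
      then have "(s, t) \<in> {0..1} \<times> {0..1}" using s by auto
      then obtain e where e: "e > 0" "\<forall>A. A \<subseteq> {0..1} \<times> {0..1} \<longrightarrow> A \<subseteq> ball (s, t) e \<longrightarrow> liftable \<gamma> A"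
        using liftable_near [OF \<gamma>] by blast
      \<comment> \<open>Both sides are shorter than \<open>e / 2\<close>, so the sum of the
        coordinate distances stays below \<open>e\<close>.\<close>
      have "liftable \<gamma> ({a..b} \<times> {u..v})"
        if u: "u \<le> t" "t \<le> v" "v - u < e / 2" "0 \<le> u" "v \<le> 1"
          and a: "0 \<le> a \<and> a \<le> s \<and> s \<le> b \<and> b \<le> 1 \<and> b - a < e / 2" for u v a b
      proof -
        have "dist (s, t) (x, y) < e" if "x \<in> {a..b}" "y \<in> {u..v}" for x y
        proof -
          have "dist (s, t) (x, y) \<le> \<bar>s - x\<bar> + \<bar>t - y\<bar>"
            unfolding dist_Pair_Pair dist_real_def using sqrt_sum_squares_le_sum_abs by auto
          then show ?thesis using that u a by auto
        qed
        then have "{a..b} \<times> {u..v} \<subseteq> ball (s, t) e" by auto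
        moreover have "{a..b} \<times> {u..v} \<subseteq> {0..1} \<times> {0..1}"
          using u a by auto
        ultimately show ?thesis using e(2) by blast
      qed
      then have "\<forall>u v. u \<le> t \<and> t \<le> v \<and> v - u < e / 2 \<longrightarrow> Q u v"
        unfolding Q_def using e(1) half_gt_zero by metis
      then show "\<exists>d>0. \<forall>u v. u \<le> t \<and> t \<le> v \<and> v - u < d \<longrightarrow> Q u v"
        using e(1) by (intro exI [of _ "e / 2"]) auto
    qed
    then show ?thesis unfolding Q_def by simp
  qed
  define P where "P a b \<longleftrightarrow> (0 \<le> a \<longrightarrow> a \<le> b \<longrightarrow> b \<le> 1 \<longrightarrow> liftable \<gamma> ({a..b} \<times> {0..1}))" for a b
  have "P 0 1"
  proof (rule Bolzano [OF zero_le_one])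
    fix a b c assume trans: "P a b" "P b c" "a \<le> b" "b \<le> c"
    show "P a c"
      unfolding P_def
    proof (intro impI)
      assume "0 \<le> a" "c \<le> 1"
      have eq: "{a..c} \<times> {0..1} = {a..b} \<times> {0..1} \<union> {b..c} \<times> {0..1::real}"
        using trans(3,4) by auto
      have int: "({a..b} \<times> {0..1}) \<inter> ({b..c} \<times> {0..1::real}) = {b..b} \<times> {0..1}"
        using trans(3,4) by auto
      show "liftable \<gamma> ({a..c} \<times> {0..1})"
        unfolding eq
      proof (rule liftable_Un)
        show "continuous_map (top_of_set ({a..b} \<times> {0..1} \<union> {b..c} \<times> {0..1})) M \<gamma>"
          using cont [of "{a..c} \<times> {0..1}"] \<open>0 \<le> a\<close> \<open>c \<le> 1\<close> unfolding eq [symmetric] by fastforce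
        show "connected (({a..b} \<times> {0..1}) \<inter> ({b..c} \<times> {0..1::real}))"
          unfolding int by (intro convex_connected convex_Times convex_real_interval)
        show "({a..b} \<times> {0..1}) \<inter> ({b..c} \<times> {0..1::real}) \<noteq> {}"
          unfolding int by auto
      qed (use trans \<open>0 \<le> a\<close> \<open>c \<le> 1\<close> in \<open>auto intro!: closed_Times simp: P_def\<close>)
    qed
  next
    fix s :: real assume "0 \<le> s" "s \<le> 1"
    then obtain d where d: "d > 0"
      "\<forall>a b. 0 \<le> a \<and> a \<le> s \<and> s \<le> b \<and> b \<le> 1 \<and> b - a < d \<longrightarrow> liftable \<gamma> ({a..b} \<times> {0..1})"
      using strip [of s] by auto
    then have "\<forall>a b. a \<le> s \<and> s \<le> b \<and> b - a < d \<longrightarrow> P a b"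
      unfolding P_def by blast
    then show "\<exists>d>0. \<forall>a b. a \<le> s \<and> s \<le> b \<and> b - a < d \<longrightarrow> P a b"
      using d(1) by blast
  qed
  then show ?thesis by (simp add: P_def)
qed

text \<open>The square case for \<open>\<gamma> \<circ> fst\<close>, restricted to an edge, replaces
  another bisection.\<close>

lemma liftable_interval:
  fixes \<gamma> :: "real \<Rightarrow> 'a"
  assumes "pathin M \<gamma>"
  shows "liftable \<gamma> {0..1}"
  unfolding liftable_def
proof (intro ballI allI impI)
  fix q \<mu> assume q: "q \<in> {0..1::real}" and \<mu>: "local_orientation n M (\<gamma> q) \<mu>"
  have "continuous_map (top_of_set ({0..1} \<times> {0..1})) M (\<gamma> \<circ> fst :: real \<times> real \<Rightarrow> 'a)"
    unfolding prod_topology_subtopology_eu [symmetric]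
    using assms unfolding pathin_def by (rule continuous_map_compose [OF continuous_map_fst])
  then have lift: "liftable (\<gamma> \<circ> fst :: real \<times> real \<Rightarrow> 'a) ({0..1} \<times> {0..1})"
    by (rule liftable_square)
  have "(q, 0) \<in> {0..1} \<times> {0..1::real}" "local_orientation n M ((\<gamma> \<circ> fst) (q, 0::real)) \<mu>"
    using q \<mu> by auto
  then obtain \<sigma> where \<sigma>: "orientation_field n M (\<gamma> \<circ> fst) ({0..1} \<times> {0..1::real}) \<sigma>" "\<sigma> (q, 0) = \<mu>"
    by (rule liftableD [OF lift])
  have "orientation_field n M ((\<gamma> \<circ> fst) \<circ> (\<lambda>t. (t, 0::real))) {0..1} (\<sigma> \<circ> (\<lambda>t. (t, 0)))"
    by (rule orientation_field_compose [OF \<sigma>(1)]) (auto intro!: continuous_intros)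
  then show "\<exists>\<sigma>. orientation_field n M \<gamma> {0..1} \<sigma> \<and> \<sigma> q = \<mu>"
    using \<sigma>(2) by (intro exI [of _ "\<sigma> \<circ> (\<lambda>t. (t, 0))"]) (simp add: comp_def)
qed

text \<open>A field depends on the parameter and might a priori vary while the point stands still.
  But the constant family with value \<open>\<sigma> p\<close> is also a field over
  \<open>C\<close>, and uniqueness identifies the two.\<close>

lemma field_const_on_connected:
  assumes \<sigma>: "orientation_field n M \<gamma> A \<sigma>" and C: "C \<subseteq> A" "connected C"
    and const: "\<And>t. t \<in> C \<Longrightarrow> \<gamma> t = x" and p: "p \<in> C" and q: "q \<in> C"
  shows "\<sigma> p = \<sigma> q"
proof -
  have \<mu>: "local_orientation n M x (\<sigma> p)"
    using \<sigma> C(1) p const [OF p] unfolding orientation_field_def by auto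
  obtain U where "openin M U" "\<gamma> p \<in> U"
    using \<sigma> C(1) p unfolding orientation_field_def by blast
  then have x: "x \<in> topspace M"
    using openin_subset const [OF p] by fastforce
  then obtain U where U: "simple_nbhd n M U" "x \<in> U"
    using simple_base [OF openin_topspace] by blast
  obtain b where b: "hom_induced (int n) M (topspace M - U) M (topspace M - {x}) id b = \<sigma> p"
    "\<And>(\<gamma> :: 'b \<Rightarrow> 'a) A. \<gamma> ` A \<subseteq> U \<Longrightarrow> orientation_field n M \<gamma> A
           (\<lambda>t. hom_induced (int n) M (topspace M - U) M (topspace M - {\<gamma> t}) id b)"
    using simple_nbhd_field [OF U \<mu>] by metis
  have "orientation_field n M (\<lambda>_. x) C (\<lambda>_. \<sigma> p)"
    using b(2) [of "\<lambda>_. x" C] U(2) unfolding b(1) by auto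
  then have "orientation_field n M \<gamma> C (\<lambda>_. \<sigma> p)"
    by (rule orientation_field_cong) (simp_all add: const)
  moreover have "continuous_map (top_of_set C) M \<gamma>"
    by (rule continuous_map_eq [of _ _ "\<lambda>_. x"]) (use x const in auto)
  ultimately show ?thesis
    using fields_eq_on_connected [OF orientation_field_subset [OF \<sigma> C(1)] _ _ C(2) p _ q, of "\<lambda>_. \<sigma> p"]
    by auto
qed

lemma contractible_loop_orientation_preserving:
  assumes "contractible_loop M \<alpha>"
  shows "orientation_preserving n M \<alpha>"
  unfolding orientation_preserving_def
proof (intro allI impI)
  fix \<mu> assume \<mu>: "local_orientation n M (\<alpha> 0) \<mu>"
  let ?Q = "{0..1} \<times> {0..1::real}"
  obtain h where h: "continuous_map (prod_topology (top_of_set {0..1::real}) (top_of_set {0..1})) M h"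
    and h0: "\<forall>t\<in>{0..1}. h (0, t) = \<alpha> t" and h1: "\<forall>t\<in>{0..1}. h (1, t) = \<alpha> 0"
    and hs: "\<forall>s\<in>{0..1}. h (s, 0) = \<alpha> 0 \<and> h (s, 1) = \<alpha> 1"
    using assms unfolding contractible_loop_def homotopic_pathsin_iff by blast
  have \<alpha>: "\<alpha> 1 = \<alpha> 0"
    using assms by (simp add: contractible_loop_def loopin_def)
  have lift: "liftable h ?Q"
    using h by (intro liftable_square) simp
  obtain \<sigma> where \<sigma>: "orientation_field n M h ?Q \<sigma>" "\<sigma> (0, 0) = \<mu>"
    using liftableD [OF lift, of "(0, 0)" \<mu>] \<mu> h0 by auto
  \<comment> \<open>The ends of the side carrying \<open>\<alpha>\<close> are joined the long way
    round the square; the homotopy fixes end points, which makes the sides at path parameters 0 and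
    1 constant.\<close>
  have "\<sigma> (0, 0) = \<sigma> (1, 0)"
    by (rule field_const_on_connected [OF \<sigma>(1), of "{0..1} \<times> {0}" "\<alpha> 0"])
      (use hs in \<open>auto intro!: convex_connected convex_Times\<close>)
  also have "\<dots> = \<sigma> (1, 1)"
    by (rule field_const_on_connected [OF \<sigma>(1), of "{1} \<times> {0..1}" "\<alpha> 0"])
      (use h1 in \<open>auto intro!: convex_connected convex_Times\<close>)
  also have "\<dots> = \<sigma> (0, 1)"
    by (rule field_const_on_connected [OF \<sigma>(1), of "{0..1} \<times> {1}" "\<alpha> 0"])
      (use hs \<alpha> in \<open>auto intro!: convex_connected convex_Times\<close>)
  finally have "\<sigma> (0, 1) = \<mu>" using \<sigma>(2) by simp
  moreover have "orientation_field n M (h \<circ> Pair 0) {0..1} (\<sigma> \<circ> Pair 0)"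
    by (rule orientation_field_compose [OF \<sigma>(1)]) (auto intro!: continuous_intros)
  then have "orientation_field n M \<alpha> {0..1} (\<sigma> \<circ> Pair 0)"
    by (rule orientation_field_cong) (use h0 in auto)
  ultimately show "\<exists>\<sigma>. orientation_translation n M \<alpha> \<sigma> \<and> \<sigma> 0 = \<mu> \<and> \<sigma> 1 = \<mu>"
    using \<sigma>(2) unfolding orientation_translation_iff_field by (intro exI [of _ "\<sigma> \<circ> Pair 0"]) simp
qed

end

section \<open>Consequences of charts: simple neighbourhoods and path-connectedness\<close>

lemma topological_manifold_simply_based:
  assumes "topological_manifold n M"
  shows "simply_based n M"
proof
  fix Q x assume Q: "openin M Q" "x \<in> Q"
  then have "x \<in> topspace M" using openin_subset by blast
  then obtain W V \<phi> \<psi> where W: "openin M W" "x \<in> W" and V: "openin (Euclidean_space n) V"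
    and chart: "homeomorphic_maps (subtopology M W) (subtopology (Euclidean_space n) V) \<phi> \<psi>"
    using topological_manifold_chart [OF assms] by blast
  have WM: "W \<subseteq> topspace M" and VE: "V \<subseteq> topspace (Euclidean_space n)"
    using W V openin_subset by auto
  have \<phi>: "continuous_map (subtopology M W) (subtopology (Euclidean_space n) V) \<phi>"
    and \<psi>: "continuous_map (subtopology (Euclidean_space n) V) M \<psi>"
    and \<psi>\<phi>: "\<And>z. z \<in> W \<Longrightarrow> \<psi> (\<phi> z) = z"
    using chart WM continuous_map_into_fulltopology unfolding homeomorphic_maps_def by auto
  have \<phi>V: "\<phi> x \<in> V"
    using continuous_map_image_subset_topspace [OF \<phi>] WM W(2) by auto
  \<comment> \<open>Pulling \<open>Q\<close> back by \<open>\<psi>\<close> before choosing the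
    radius puts the whole coordinate ball inside \<open>Q\<close>.\<close>
  have "openin (subtopology (Euclidean_space n) V) {v \<in> topspace (subtopology (Euclidean_space n) V). \<psi> v \<in> Q}"
    using \<psi> Q(1) by (rule openin_continuous_map_preimage)
  then have "openin (Euclidean_space n) {v \<in> topspace (subtopology (Euclidean_space n) V). \<psi> v \<in> Q}"
    using V by (rule openin_trans_full)
  moreover have "\<phi> x \<in> {v \<in> topspace (subtopology (Euclidean_space n) V). \<psi> v \<in> Q}"
    using \<phi>V VE \<psi>\<phi> [OF W(2)] Q(2) by auto
  ultimately obtain r where r: "r > 0"
    "\<And>v. v \<in> topspace (Euclidean_space n) \<Longrightarrow> (\<Sum>i<n. \<bar>v i - \<phi> x i\<bar>) \<le> r \<Longrightarrow> v \<in> V \<and> \<psi> v \<in> Q"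
    using Euclidean_space_contains_l1_ball [of n _ "\<phi> x"] by (smt (verit) IntD2 mem_Collect_eq topspace_subtopology)
  \<comment> \<open>A third of \<open>r\<close>, because the ball of three times the radius has to
    fit into the chart.\<close>
  let ?U = "{z \<in> W. (\<Sum>i<n. \<bar>\<phi> z i - \<phi> x i\<bar>) < r / 3}"
  have "simple_nbhd n M ?U"
    by (rule simple_coordinate_ball [OF _ W(1) V chart]) (use assms r \<phi>V VE in \<open>auto simp: topological_manifold_def\<close>)
  moreover have "x \<in> ?U"
    using W(2) r(1) by simp
  moreover have "?U \<subseteq> Q"
  proof
    fix z assume z: "z \<in> ?U"
    then have "\<phi> z \<in> topspace (Euclidean_space n)"
      using continuous_map_image_subset_topspace [OF \<phi>] WM by auto
    then have "\<psi> (\<phi> z) \<in> Q"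
      using r z by auto
    then show "z \<in> Q" using \<psi>\<phi> z by auto
  qed
  ultimately show "\<exists>U. simple_nbhd n M U \<and> x \<in> U \<and> U \<subseteq> Q" by blast
qed

text \<open>Charts carry over local path-connectedness, which upgrades connectedness. This supplies
  the path from a given root to the base point of a reversing loop.\<close>

lemma topological_manifold_path_connected:
  assumes M: "topological_manifold n M" "connected_space M"
  shows "path_connected_space M"
proof -
  have "locally_path_connected_space M"
    unfolding locally_path_connected_space
  proof (intro allI impI)
    fix Q x assume Q: "openin M Q \<and> x \<in> Q"
    then have "x \<in> topspace M" using openin_subset by blast
    then obtain W V \<phi> \<psi> where W: "openin M W" "x \<in> W" and V: "openin (Euclidean_space n) V"
      and chart: "homeomorphic_maps (subtopology M W) (subtopology (Euclidean_space n) V) \<phi> \<psi>"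
      using topological_manifold_chart [OF M(1)] by blast
    have "locally_path_connected_space (subtopology (Euclidean_space n) V)"
      using V locally_path_connected_Euclidean_space locally_path_connected_space_open_subset by blast
    then have "locally_path_connected_space (subtopology M W)"
      using chart homeomorphic_locally_path_connected_space homeomorphic_space_def by metis
    moreover have "openin (subtopology M W) (Q \<inter> W)" "x \<in> Q \<inter> W"
      using Q W by (auto simp: openin_open_subtopology)
    ultimately obtain U where "openin (subtopology M W) U" "path_connectedin (subtopology M W) U" "x \<in> U" "U \<subseteq> Q \<inter> W"
      unfolding locally_path_connected_space by meson
    then show "\<exists>U. openin M U \<and> path_connectedin M U \<and> x \<in> U \<and> U \<subseteq> Q"
      using openin_trans_full [OF _ W(1)] by (auto simp: path_connectedin_subtopology)
  qed
  then show ?thesis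
    using M(2) path_connected_eq_connected_space by blast
qed

section \<open>Conjugated loops\<close>

text \<open>The clamping to \<open>[0, 1]\<close> makes every branch continuous on the whole parameter space, so that
  the branches can be pasted without restricting them.\<close>

definition conjugate_path :: "(real \<Rightarrow> 'a) \<Rightarrow> (real \<Rightarrow> 'a) \<Rightarrow> real \<Rightarrow> 'a" where
  "conjugate_path w \<alpha> t =
     (if t \<le> 1/3 then w (max 0 (min 1 (3 * t)))
      else if t \<le> 2/3 then \<alpha> (max 0 (min 1 (3 * t - 1)))
      else w (max 0 (min 1 (3 - 3 * t))))"

lemma conjugate_path_endpoints [simp]: "conjugate_path w \<alpha> 0 = w 0" "conjugate_path w \<alpha> 1 = w 0"
  by (simp_all add: conjugate_path_def)

lemma conjugate_path_compose: "f \<circ> conjugate_path w \<alpha> = conjugate_path (f \<circ> w) (f \<circ> \<alpha>)"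
  by (simp add: conjugate_path_def fun_eq_iff)

text \<open>The parameter space \<open>Z\<close> lets one pasting argument serve single paths and
  homotopies alike. The condition on \<open>h\<close> is the matching of the branches at 1/3 and
  2/3.\<close>

lemma continuous_map_conjugate_path:
  fixes h :: "'c \<times> real \<Rightarrow> 'a" and u :: "real \<Rightarrow> 'a"
  assumes u: "pathin X u" and h: "continuous_map (prod_topology Z (top_of_set {0..1})) X h"
    and eq: "\<And>s. s \<in> topspace Z \<Longrightarrow> h (s, 0) = u 1 \<and> h (s, 1) = u 1"
  shows "continuous_map (prod_topology Z (top_of_set {0..1})) X
           (\<lambda>(s, t). conjugate_path u (\<lambda>t. h (s, t)) t)"
proof -
  let ?P = "prod_topology Z (top_of_set {0..1::real})"
  have t: "continuous_map ?P euclideanreal snd"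
    using continuous_map_into_fulltopology [OF continuous_map_snd] .
  have clamp: "continuous_map ?P (top_of_set {0..1}) (\<lambda>q. max 0 (min 1 (a + b * snd q)))" for a b :: real
    unfolding continuous_map_in_subtopology by (auto intro!: continuous_intros t)
  have 1: "continuous_map ?P X (\<lambda>q. u (max 0 (min 1 (a + b * snd q))))" for a b
    using continuous_map_compose [OF clamp u [unfolded pathin_def]] by (simp add: comp_def)
  have 2: "continuous_map ?P X (\<lambda>q. h (fst q, max 0 (min 1 (a + b * snd q))))" for a b
  proof -
    have "continuous_map ?P ?P (\<lambda>q. (fst q, max 0 (min 1 (a + b * snd q))))"
      by (intro continuous_map_pairedI continuous_map_fst clamp)
    then show ?thesis
      using continuous_map_compose [OF _ h] by (fastforce simp: comp_def)
  qed
  \<comment> \<open>All arguments are written as \<open>a + b * snd q\<close>, the shape in which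
    the clamped branches were shown continuous.\<close>
  have "continuous_map ?P X (\<lambda>q. if snd q \<le> 1/3 then u (max 0 (min 1 (0 + 3 * snd q)))
      else if snd q \<le> 2/3 then h (fst q, max 0 (min 1 (-1 + 3 * snd q)))
      else u (max 0 (min 1 (3 + (-3) * snd q))))"
    by (intro continuous_map_cases_le continuous_map_from_subtopology 1 2 t continuous_intros)
      (use eq in auto)
  moreover have "(\<lambda>q. if snd q \<le> 1/3 then u (max 0 (min 1 (0 + 3 * snd q)))
      else if snd q \<le> 2/3 then h (fst q, max 0 (min 1 (-1 + 3 * snd q)))
      else u (max 0 (min 1 (3 + (-3) * snd q)))) = (\<lambda>(s, t). conjugate_path u (\<lambda>t. h (s, t)) t)"
    by (auto simp: conjugate_path_def fun_eq_iff algebra_simps)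
  ultimately show ?thesis by simp
qed

lemma pathin_conjugate_path:
  assumes w: "pathin X w" and \<alpha>: "loopin X \<alpha>" and eq: "w 1 = \<alpha> 0"
  shows "pathin X (conjugate_path w \<alpha>)"
proof -
  let ?I = "top_of_set {0..1::real}"
  have "continuous_map (prod_topology ?I ?I) X (\<alpha> \<circ> snd)"
    using \<alpha> unfolding loopin_def pathin_def by (blast intro: continuous_map_compose [OF continuous_map_snd])
  then have c: "continuous_map (prod_topology ?I ?I) X
      (\<lambda>(s, t). conjugate_path w (\<lambda>t. (\<alpha> \<circ> snd) (s, t)) t)"
    by (rule continuous_map_conjugate_path [OF w]) (use \<alpha> eq in \<open>auto simp: loopin_def\<close>)
  have "continuous_map ?I (prod_topology ?I ?I) (\<lambda>t. (0, t))"
    by (intro continuous_map_pairedI) auto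
  from continuous_map_compose [OF this c] show ?thesis
    by (simp add: pathin_def comp_def)
qed

text \<open>The middle loop is contracted while \<open>u\<close> stays fixed; what remains runs
  along \<open>u\<close> and back, and is retracted along \<open>u\<close> to its start.\<close>

lemma conjugate_path_contractible:
  assumes u: "pathin X u" and \<beta>: "contractible_loop X \<beta>" and eq: "u 1 = \<beta> 0"
  shows "homotopic_pathsin X (conjugate_path u \<beta>) (\<lambda>_. u 0)"
proof -
  let ?I = "top_of_set {0..1::real}"
  obtain h where h: "continuous_map (prod_topology ?I ?I) X h"
    and h0: "\<forall>t\<in>{0..1}. h (0, t) = \<beta> t" and h1: "\<forall>t\<in>{0..1}. h (1, t) = \<beta> 0"
    and hs: "\<forall>s\<in>{0..1}. h (s, 0) = \<beta> 0 \<and> h (s, 1) = \<beta> 1"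
    using \<beta> unfolding contractible_loop_def homotopic_pathsin_iff by blast
  have \<beta>1: "\<beta> 1 = \<beta> 0"
    using \<beta> by (simp add: contractible_loop_def loopin_def)
  have c1: "continuous_map (prod_topology ?I ?I) X (\<lambda>(s, t). conjugate_path u (\<lambda>t. h (s, t)) t)"
    by (rule continuous_map_conjugate_path [OF u h]) (use hs \<beta>1 eq in auto)
  have "homotopic_pathsin X (conjugate_path u \<beta>) (conjugate_path u (\<lambda>_. \<beta> 0))"
    unfolding homotopic_pathsin_iff
    by (intro exI conjI, rule c1) (use h0 h1 in \<open>auto simp: conjugate_path_def\<close>)
  moreover have "homotopic_with (\<lambda>r. r 0 = u 0 \<and> r 1 = u 0) ?I X (conjugate_path u (\<lambda>_. \<beta> 0)) (\<lambda>_. u 0)"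
  proof -
    \<comment> \<open>A tent truncated at height 1 and scaled by \<open>1 - s\<close>: at
      \<open>s = 0\<close> composition with \<open>u\<close> gives the path out, the rest at
      \<open>u 1\<close> and the way back; at later times the path turns round earlier.\<close>
    let ?m = "\<lambda>q::real \<times> real. (1 - fst q) * max 0 (min 1 (min (3 * snd q) (3 - 3 * snd q)))"
    have f: "continuous_map (prod_topology ?I ?I) euclideanreal fst"
      by (rule continuous_map_into_fulltopology [OF continuous_map_fst])
    have s: "continuous_map (prod_topology ?I ?I) euclideanreal snd"
      by (rule continuous_map_into_fulltopology [OF continuous_map_snd])
    have "continuous_map (prod_topology ?I ?I) euclideanreal ?m"
      by (intro continuous_intros f s)
    moreover have "?m q \<in> {0..1}" if "q \<in> {0..1} \<times> {0..1}" for q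
      using that by (auto intro!: mult_nonneg_nonneg mult_le_one)
    ultimately have "continuous_map (prod_topology ?I ?I) ?I ?m"
      unfolding continuous_map_in_subtopology by auto
    then have c2: "continuous_map (prod_topology ?I ?I) X (u \<circ> ?m)"
      using u unfolding pathin_def by (rule continuous_map_compose)
    have "homotopic_pathsin X (conjugate_path u (\<lambda>_. \<beta> 0)) (\<lambda>_. u 0)"
      unfolding homotopic_pathsin_iff
      by (intro exI conjI, rule c2) (auto simp: conjugate_path_def eq [symmetric] max_def min_def)
    then show ?thesis by (simp add: homotopic_pathsin_def)
  qed
  ultimately show ?thesis
    unfolding homotopic_pathsin_def by (simp add: homotopic_with_trans)
qed

context simply_based
begin

text \<open>Carry \<open>\<mu>\<close> backwards along \<open>w\<close> and then translate along the
  conjugate, which returns to the same value at \<open>w 0\<close>. By uniqueness along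
  \<open>w\<close>, the translation has value \<open>\<mu>\<close> at both ends of the middle third.
  The contrapositive is what is used: conjugates of reversing loops are reversing.\<close>

lemma orientation_preserving_conjugate:
  assumes w: "pathin M w" and \<alpha>: "loopin M \<alpha>" and eq: "w 1 = \<alpha> 0"
    and pres: "orientation_preserving n M (conjugate_path w \<alpha>)"
  shows "orientation_preserving n M \<alpha>"
  unfolding orientation_preserving_def
proof (intro allI impI)
  fix \<mu> assume \<mu>: "local_orientation n M (\<alpha> 0) \<mu>"
  let ?\<gamma> = "conjugate_path w \<alpha>"
  obtain \<tau> where \<tau>: "orientation_field n M w {0..1} \<tau>" "\<tau> 1 = \<mu>"
    using liftableD [OF liftable_interval [OF w], of 1 \<mu>] \<mu> eq by auto
  then have "local_orientation n M (?\<gamma> 0) (\<tau> 0)"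
    by (auto simp: orientation_field_def)
  then obtain \<sigma> where \<sigma>: "orientation_field n M ?\<gamma> {0..1} \<sigma>" "\<sigma> 0 = \<tau> 0" "\<sigma> 1 = \<tau> 0"
    using pres unfolding orientation_preserving_def orientation_translation_iff_field by blast
  have restrict: "orientation_field n M \<delta> {0..1} (\<sigma> \<circ> k)"
    if "continuous_on {0..1} k" "k ` {0..1} \<subseteq> {0..1}" "\<And>t. t \<in> {0..1} \<Longrightarrow> \<delta> t = ?\<gamma> (k t)" for k :: "real \<Rightarrow> real" and \<delta>
    by (rule orientation_field_cong [OF orientation_field_compose [OF \<sigma>(1) that(1,2)]]) (simp_all add: that(3))
  have wc: "continuous_map (top_of_set {0..1}) M w"
    using w by (simp add: pathin_def)
  have unique: "\<rho> 1 = \<mu>" if "orientation_field n M w {0..1} \<rho>" "\<rho> 0 = \<tau> 0" for \<rho>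
    using fields_eq_on_connected [OF that(1) wc \<tau>(1) _ _ that(2), of 1] \<tau>(2) by simp
  have "(\<sigma> \<circ> (\<lambda>t. t / 3)) 1 = \<mu>"
    by (rule unique [OF restrict])
      (auto intro!: continuous_intros simp: conjugate_path_def \<sigma>(2))
  \<comment> \<open>The last third read backwards is again the path \<open>w\<close>, starting from
    \<open>\<sigma> 1 = \<tau> 0\<close>, so the same uniqueness applies.\<close>
  moreover have "(\<sigma> \<circ> (\<lambda>t. 1 - t / 3)) 1 = \<mu>"
    by (rule unique [OF restrict])
      (use \<alpha> eq in \<open>auto intro!: continuous_intros simp: conjugate_path_def loopin_def \<sigma>(3) field_simps\<close>)
  moreover have "orientation_field n M \<alpha> {0..1} (\<sigma> \<circ> (\<lambda>t. (t + 1) / 3))"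
    by (rule restrict)
      (use \<alpha> eq in \<open>auto intro!: continuous_intros simp: conjugate_path_def loopin_def field_simps\<close>)
  ultimately show "\<exists>\<sigma>. orientation_translation n M \<alpha> \<sigma> \<and> \<sigma> 0 = \<mu> \<and> \<sigma> 1 = \<mu>"
    unfolding orientation_translation_iff_field
    by (intro exI [of _ "\<sigma> \<circ> (\<lambda>t. (t + 1) / 3)"]) simp
qed

end

section \<open>Defective root classes\<close>

theorem theorem2p2:
  fixes M :: "'a topology" and N :: "'b topology" and f :: "'a \<Rightarrow> 'b" and n :: nat and c :: 'b
  assumes "topological_manifold n M" and "connected_space M"
    and "topological_manifold n N" and "connected_space N"
    and "continuous_map M N f"
    and "c \<in> topspace N"
  shows "(orientable_map n M N f \<longrightarrow>
            (\<forall>R \<in> root_classes M N f c. \<not> defective n M N f (\<lambda>_. c) R)) \<and>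
         (type_III n M N f \<longrightarrow>
            (\<forall>R \<in> root_classes M N f c. defective n M N f (\<lambda>_. c) R))"
proof (intro conjI impI ballI)
  interpret M: simply_based n M
    using assms(1) by (rule topological_manifold_simply_based)
  interpret N: simply_based n N
    using assms(3) by (rule topological_manifold_simply_based)
  have f_path: "pathin N (f \<circ> w)" if "pathin M w" for w
    using that assms(5) by (rule pathin_compose)
  \<comment> \<open>For the pair of \<open>f\<close> and a constant, the homotopy in the definition
    of a self-reducing point is a contraction of the image loop.\<close>
  have null: "orientation_preserving n N (f \<circ> \<alpha>)" "contractible_loop N (f \<circ> \<alpha>)"
    if "loopin M \<alpha>" "f (\<alpha> 0) = c" "homotopic_pathsin N (f \<circ> \<alpha>) ((\<lambda>_. c) \<circ> \<alpha>)" for \<alpha>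
  proof -
    show *: "contractible_loop N (f \<circ> \<alpha>)"
      using that f_path [of \<alpha>] by (simp add: contractible_loop_def loopin_def comp_def)
    show "orientation_preserving n N (f \<circ> \<alpha>)"
      using * by (rule N.contractible_loop_orientation_preserving)
  qed
  {
    fix R assume "orientable_map n M N f"
    show "\<not> defective n M N f (\<lambda>_. c) R"
    proof
      assume "defective n M N f (\<lambda>_. c) R"
      then obtain x \<alpha> where "f x = c" and \<alpha>: "loopin M \<alpha>" "\<alpha> 0 = x"
        and hom: "homotopic_pathsin N (f \<circ> \<alpha>) ((\<lambda>_. c) \<circ> \<alpha>)"
        and ne: "orientation_preserving n M \<alpha> \<noteq> orientation_preserving n N (f \<circ> \<alpha>)"
        unfolding defective_def self_reducing_def Coin_def by blast
      with null [of \<alpha>] have "orientation_reversing n M \<alpha>" "contractible_loop N (f \<circ> \<alpha>)"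
        by (auto simp: orientation_reversing_def)
      \<comment> \<open>The same loop refutes both types: its image preserves orientation although
        it does not, against Type I, and its image contracts, against Type II.\<close>
      with \<alpha> ne \<open>orientable_map n M N f\<close> show False
        unfolding orientable_map_def type_I_def type_II_def orientation_true_def by blast
    qed
  next
    fix R assume "type_III n M N f" and R: "R \<in> root_classes M N f c"
    then obtain \<alpha> where \<alpha>: "loopin M \<alpha>" "orientation_reversing n M \<alpha>" "contractible_loop N (f \<circ> \<alpha>)"
      unfolding type_III_def by blast
    obtain x where x: "x \<in> topspace M" "f x = c" and Rx: "R = Nielsen_related M N f (\<lambda>_. c) `` {x}"
      using R unfolding root_classes_def coincidence_classes_def quotient_def Coin_def by auto
    \<comment> \<open>The constant path shows that \<open>x\<close> is related to itself, hence
      belongs to the class it generates.\<close>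
    have "homotopic_pathsin N (f \<circ> (\<lambda>_. x)) ((\<lambda>_. c) \<circ> (\<lambda>_. x))"
      unfolding homotopic_pathsin_iff using x(2) assms(6) by (intro exI [of _ "\<lambda>_. c"]) simp
    then have "x \<in> R"
      unfolding Rx Nielsen_related_def Coin_def using x by (auto intro!: exI [of _ "\<lambda>_. x"])
    have "\<alpha> 0 \<in> topspace M"
      using \<alpha>(1) path_start_in_topspace unfolding loopin_def by blast
    then obtain w where w: "pathin M w" "w 0 = x" "w 1 = \<alpha> 0"
      using topological_manifold_path_connected [OF assms(1,2)] x(1)
      unfolding path_connected_space_def by blast
    let ?\<beta> = "conjugate_path w \<alpha>"
    have \<beta>: "loopin M ?\<beta>" "?\<beta> 0 = x"
      using pathin_conjugate_path [OF w(1) \<alpha>(1) w(3)] w(2) by (simp_all add: loopin_def)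
    have hom: "homotopic_pathsin N (f \<circ> ?\<beta>) ((\<lambda>_. c) \<circ> ?\<beta>)"
      using conjugate_path_contractible [OF f_path [OF w(1)] \<alpha>(3)] w x(2)
      by (simp add: conjugate_path_compose comp_def [of "\<lambda>_. c"])
    have "\<not> orientation_preserving n M ?\<beta>"
      using M.orientation_preserving_conjugate [OF w(1) \<alpha>(1) w(3)] \<alpha>(2)
      by (auto simp: orientation_reversing_def)
    then have "self_reducing n M N f (\<lambda>_. c) x"
      unfolding self_reducing_def Coin_def using x \<beta> hom null(1) [OF \<beta>(1) _ hom] by auto
    then show "defective n M N f (\<lambda>_. c) R"
      using \<open>x \<in> R\<close> unfolding defective_def by blast
  }
qed

end
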